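(* Consider the linear regression model $y=X\theta+u$ (context). Suppose that for a given $i\ge1$ with $i\le k=k(n)$ for all large enough $n$ we have $\xi_{i,n}\eta_{i,n}\to0$, $n-k\to\infty$, and $n^{1/2}\eta_{i,n}/(n-k)^{1/2}\to0$. Let $a_{i,n}$ be any sequence of non-negative reals, $E_{AS,i,n}=[\tilde\theta_{AS,i}-\hat\sigma a_{i,n},\tilde\theta_{AS,i}+\hat\sigma a_{i,n}]$ and $C_{AS,i,n}=[\hat\theta_{AS,i}-\sigma a_{i,n},\hat\theta_{AS,i}+\sigma a_{i,n}]$. Then, for any $\sigma>0$, $$\inf_{\theta\in\mathbb{R}^k,\sigma'\in(0,\infty)}P_{n,\theta,\sigma'}(\theta_i\in E_{AS,i,n})-\inf_{\theta\in\mathbb{R}^k}P_{n,\theta,\sigma}(\theta_i\in C_{AS,i,n})\longrightarrow0\quad(n\to\infty).$$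
   Context: Model: for each $n$, $y=X\theta+u$ with $y\in\mathbb{R}^n$, $X$ a non-stochastic $n\times k$ matrix of rank $k\ge1$ ($k=k(n)$ and all entries may depend on $n$), $\theta\in\mathbb{R}^k$, $u\sim N(0,\sigma^2I_n)$, $\sigma>0$. $P_{n,\theta,\sigma}$ is the probability under $(\theta,\sigma)$. $\hat\theta_{LS}=(X'X)^{-1}X'y$, $\hat\sigma^2=(y-X\hat\theta_{LS})'(y-X\hat\theta_{LS})/(n-k)$ (for $n>k$), $\xi_{i,n}\ge0$ with $\xi_{i,n}^2=((X'X/n)^{-1})_{ii}$. Standing assumption for asymptotic results: $\sup_n\xi_{i,n}^2/n<\infty$. Tuning parameters $\eta_{i,n}>0$. Adaptive soft-thresholding: known-variance $\hat\theta_{AS,i}=\hat\theta_{LS,i}(1-\sigma^2\xi_{i,n}^2\eta_{i,n}^2/\hat\theta_{LS,i}^2)_+$, feasible $\tilde\theta_{AS,i}=\hat\theta_{LS,i}(1-\hat\sigma^2\xi_{i,n}^2\eta_{i,n}^2/\hat\theta_{LS,i}^2)_+$. *)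

theory Defs
  imports "HOL-Probability.Probability" "Jordan_Normal_Form.DL_Rank"
    "Jordan_Normal_Form.Gauss_Jordan_Elimination"
begin

text \<open>Design matrix X is an n x k real matrix (Jordan_Normal_Form type real mat);
  indices are 0-based. The inverse of X'X is taken via mat_inverse.\<close>

definition XtX_inv :: "real mat \<Rightarrow> real mat" where
  "XtX_inv X = the (mat_inverse (transpose_mat X * X))"

definition theta_LS :: "real mat \<Rightarrow> real vec \<Rightarrow> real vec" where
  "theta_LS X y = XtX_inv X *\<^sub>v (transpose_mat X *\<^sub>v y)"

definition sigma2_hat :: "real mat \<Rightarrow> real vec \<Rightarrow> real" where
  "sigma2_hat X y = (let r = y - X *\<^sub>v theta_LS X y
     in (r \<bullet> r) / (real (dim_row X) - real (dim_col X)))"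

text \<open>xi_{i,n} >= 0 with xi^2 = ((X'X/n)^{-1})_{ii} = n ((X'X)^{-1})_{ii}\<close>
definition xi :: "real mat \<Rightarrow> nat \<Rightarrow> real" where
  "xi X i = sqrt (real (dim_row X) * (XtX_inv X $$ (i, i)))"

definition soft :: "real \<Rightarrow> real \<Rightarrow> real" where
  "soft b c = b * max 0 (1 - c / b\<^sup>2)"

definition theta_AS :: "real mat \<Rightarrow> real \<Rightarrow> nat \<Rightarrow> real \<Rightarrow> real vec \<Rightarrow> real" where
  "theta_AS X \<sigma> i \<eta> y =
     soft (theta_LS X y $ i) (\<sigma>\<^sup>2 * (xi X i)\<^sup>2 * \<eta>\<^sup>2)"

definition theta_AS_feas :: "real mat \<Rightarrow> nat \<Rightarrow> real \<Rightarrow> real vec \<Rightarrow> real" where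
  "theta_AS_feas X i \<eta> y =
     soft (theta_LS X y $ i) (sigma2_hat X y * (xi X i)\<^sup>2 * \<eta>\<^sup>2)"

text \<open>Distribution of y = X theta + u, u ~ N(0, sigma^2 I_n), as a measure on
  functions {..<n} -> real (components independent N((X theta)_j, sigma^2)).\<close>
definition y_law :: "real mat \<Rightarrow> real vec \<Rightarrow> real \<Rightarrow> (nat \<Rightarrow> real) measure" where
  "y_law X \<theta> \<sigma> = PiM {..<dim_row X}
     (\<lambda>j. density lborel (normal_density ((X *\<^sub>v \<theta>) $ j) \<sigma>))"

definition Pr :: "real mat \<Rightarrow> real vec \<Rightarrow> real \<Rightarrow> (real vec \<Rightarrow> bool) \<Rightarrow> real" where
  "Pr X \<theta> \<sigma> E = measure (y_law X \<theta> \<sigma>)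
     {y \<in> space (y_law X \<theta> \<sigma>). E (vec (dim_row X) y)}"

end

theory Submission
  imports Defs
begin

text \<open>
  Let \<open>\<nu>\<close>, \<open>\<alpha>\<close>, \<open>e\<close> be \<open>\<theta>\<^sub>i\<close>, the half width \<open>a\<close> and the threshold \<open>\<xi> \<eta>\<close> measured in the
  appropriate standard error units (so \<open>e = \<surd>n \<eta>\<close>), \<open>Z\<close> the standardised error of the least squares
  estimator and \<open>S = \<sigma>_hat / \<sigma>\<close>. Both coverage events then read
  \<open>\<bar>\<nu> - soft (\<nu> + Z) (S\<^sup>2 e\<^sup>2)\<bar> \<le> S \<alpha>\<close>, with \<open>S = 1\<close> in the known-variance case.
  Whenever \<open>\<bar>S - 1\<bar> \<le> \<delta>\<close>, this event lies between two events \<open>l \<le> Z \<le> u\<close> with non-random endpoints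
  that differ by a quantity of order \<open>\<delta> (\<alpha> + e)\<close>. The part of order \<open>\<delta> \<alpha>\<close> only matters where the
  normal density is tiny, so the infimal coverage is
  \<open>\<Phi> (\<surd>(\<alpha>\<^sup>2 + e\<^sup>2)) - \<Phi> (e - \<alpha>)\<close> up to \<open>P (\<bar>S - 1\<bar> > \<delta>) + O (\<delta> (1 + e))\<close> in both cases.
  Only the marginal laws of \<open>Z\<close> and \<open>S\<close> enter, not their independence. By Chebyshev applied to the
  residual quadratic form, \<open>P (\<bar>S - 1\<bar> > \<delta>) \<le> 2 / ((n - k) \<delta>\<^sup>2)\<close>, and
  \<open>\<delta>\<^sup>2 = 1 / ((1 + e) \<surd>(n - k))\<close> makes every error term vanish.
\<close>

section \<open>Soft thresholding\<close>

text \<open>Triangle inequality in the plane for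
  \<open>(y, 2 * c) = (x, 2 * c) + (y - x, 0)\<close>. It serves to shift the argument in roots of
  the quadratics below.\<close>

lemma sqrt_add_sq_diff_antimono:
  fixes x y c d :: real
  assumes "x \<le> y"
  shows "sqrt (y\<^sup>2 + 4 * c\<^sup>2) - y \<le> sqrt (x\<^sup>2 + 4 * c\<^sup>2) - x"
  using real_sqrt_sum_squares_triangle_ineq[of x "y - x" "2 * c" 0] assms
  by (simp add: power_mult_distrib)

lemma soft_minus: "soft (- b) c = - soft b c"
  by (simp add: soft_def)

lemma soft_scale: "s > 0 \<Longrightarrow> soft (s * b) (s\<^sup>2 * c) = s * soft b c"
  by (simp add: soft_def power_mult_distrib)

lemma soft_nonneg: "0 \<le> b \<Longrightarrow> 0 \<le> soft b c"
  by (simp add: soft_def)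

lemma soft_eq:
  assumes "c > 0" "c < b" shows "soft b (c\<^sup>2) = b - c\<^sup>2 / b"
proof -
  have "c\<^sup>2 / b\<^sup>2 \<le> 1" using assms by (simp add: power_mono)
  then show ?thesis using assms by (simp add: soft_def right_diff_distrib power2_eq_square)
qed

lemma soft_nonpos:
  assumes "c > 0" "b \<le> c" shows "soft b (c\<^sup>2) \<le> 0"
proof (cases "b \<le> 0")
  case True then show ?thesis by (simp add: soft_def mult_nonpos_nonneg)
next
  case False
  then have "c\<^sup>2 / b\<^sup>2 \<ge> 1" using assms by (simp add: power_mono)
  then show ?thesis by (simp add: soft_def)
qed

text \<open>For \<open>b > c\<close> the inequality \<open>b - c\<^sup>2 / b \<le> x\<close> is
  quadratic in \<open>b\<close> and the bound is its larger root; for \<open>b \<le> c\<close> both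
  sides hold, since that root is at least \<open>c\<close>.\<close>

lemma soft_le_iff:
  assumes c: "c > 0" and x: "0 \<le> x"
  shows "soft b (c\<^sup>2) \<le> x \<longleftrightarrow> b \<le> (x + sqrt (x\<^sup>2 + 4 * c\<^sup>2)) / 2"
proof (cases "b \<le> c")
  case True
  have "2 * c \<le> sqrt (x\<^sup>2 + 4 * c\<^sup>2)"
    by (rule real_le_rsqrt) (simp add: power_mult_distrib)
  then have "b \<le> (x + sqrt (x\<^sup>2 + 4 * c\<^sup>2)) / 2" using True x by (simp add: field_simps)
  then show ?thesis using soft_nonpos[OF c True] x by linarith
next
  case False
  then have b: "b > c" "b > 0" using c by auto
  have "soft b (c\<^sup>2) \<le> x \<longleftrightarrow> b * b - c\<^sup>2 \<le> x * b"
    using b c soft_eq[OF c b(1)] mult_le_cancel_left_pos[OF b(2), of "soft b (c\<^sup>2)" x]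
    by (simp add: right_diff_distrib power2_eq_square mult.commute)
  also have "\<dots> \<longleftrightarrow> (2 * b - x)\<^sup>2 \<le> x\<^sup>2 + 4 * c\<^sup>2"
  proof -
    have "(2 * b - x)\<^sup>2 - (x\<^sup>2 + 4 * c\<^sup>2) = 4 * (b * b - c\<^sup>2 - x * b)"
      by (simp add: power2_eq_square algebra_simps)
    then have "(2 * b - x)\<^sup>2 \<le> x\<^sup>2 + 4 * c\<^sup>2 \<longleftrightarrow> 4 * (b * b - c\<^sup>2 - x * b) \<le> 0" by linarith
    then show ?thesis by argo
  qed
  also have "\<dots> \<longleftrightarrow> 2 * b - x \<le> sqrt (x\<^sup>2 + 4 * c\<^sup>2)"
  proof
    assume "(2 * b - x)\<^sup>2 \<le> x\<^sup>2 + 4 * c\<^sup>2"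
    then show "2 * b - x \<le> sqrt (x\<^sup>2 + 4 * c\<^sup>2)" by (rule real_le_rsqrt)
  next
    assume *: "2 * b - x \<le> sqrt (x\<^sup>2 + 4 * c\<^sup>2)"
    have "- (2 * b - x) \<le> sqrt (x\<^sup>2)" using b x by simp
    also have "\<dots> \<le> sqrt (x\<^sup>2 + 4 * c\<^sup>2)" by (rule real_sqrt_le_mono) simp
    finally have "\<bar>2 * b - x\<bar> \<le> \<bar>sqrt (x\<^sup>2 + 4 * c\<^sup>2)\<bar>" using * by linarith
    then have "(2 * b - x)\<^sup>2 \<le> (sqrt (x\<^sup>2 + 4 * c\<^sup>2))\<^sup>2" by (rule abs_le_square_iff[THEN iffD1])
    then show "(2 * b - x)\<^sup>2 \<le> x\<^sup>2 + 4 * c\<^sup>2" by simp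
  qed
  finally show ?thesis by (simp add: field_simps)
qed

text \<open>The same quadratic from the other side. For \<open>x = 0\<close> the converse fails,
  because \<open>soft\<close> vanishes on the whole interval from \<open>0\<close> to
  \<open>c\<close>.\<close>

lemma soft_ge:
  assumes c: "c > 0" and x: "0 \<le> x" and b: "b \<ge> (x + sqrt (x\<^sup>2 + 4 * c\<^sup>2)) / 2"
  shows "soft b (c\<^sup>2) \<ge> x"
proof -
  have R: "x \<le> sqrt (x\<^sup>2 + 4 * c\<^sup>2)" "2 * c \<le> sqrt (x\<^sup>2 + 4 * c\<^sup>2)"
    by (rule real_le_rsqrt, simp add: power_mult_distrib)+
  show ?thesis
  \<comment> \<open>The root is at least \<open>c\<close>, so \<open>b = c\<close> forces
    \<open>x = 0\<close> and only nonnegativity remains.\<close>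
  proof (cases "b = c")
    case True
    then show ?thesis using R x b c soft_nonneg[of b "c\<^sup>2"] by auto
  next
    case False
    then have bc: "b > c" "b > 0" using R b c x by auto
    have "(sqrt (x\<^sup>2 + 4 * c\<^sup>2))\<^sup>2 \<le> (2 * b - x)\<^sup>2"
      using b by (intro power_mono) auto
    then have "b * x \<le> b * b - c\<^sup>2"
      by (simp add: power2_eq_square algebra_simps)
    then have "c\<^sup>2 \<le> (b - x) * b" by (simp add: algebra_simps)
    then have "c\<^sup>2 / b \<le> b - x" by (subst pos_divide_le_eq[OF bc(2)])
    then show ?thesis using soft_eq[OF c bc(1)] by simp
  qed
qed

text \<open>The shrinkage factor lies between 0 and 1, so a negative \<open>b\<close> is only moved
  up.\<close>

lemma soft_ge_nonpos:
  assumes "0 \<le> c" "x \<le> 0" "x \<le> b" shows "x \<le> soft b c"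
proof (cases "0 \<le> b")
  case True then show ?thesis using assms soft_nonneg[of b c] by linarith
next
  case False
  have "max 0 (1 - c / b\<^sup>2) \<le> 1" using assms by simp
  then have "b * 1 \<le> b * max 0 (1 - c / b\<^sup>2)" using False by (intro mult_left_mono_neg) auto
  then show ?thesis using assms by (simp add: soft_def)
qed

text \<open>One interval for \<open>z\<close> that serves every \<open>s\<close> within
  \<open>\<delta>\<close> of 1. It is the acceptance interval at scale \<open>s1\<close> and
  parameter \<open>\<nu>1\<close>, narrowed at both ends by
  \<open>2 * \<delta> * (\<alpha> + e)\<close> to absorb the change from \<open>s1\<close> to
  \<open>s\<close>. The truncations give \<open>t = \<nu>1 - s1 * \<alpha>\<close>, the form needed
  for \<open>coverage_mono\<close>.\<close>

lemma soft_cover_if: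
  fixes \<nu> \<alpha> e \<delta> s z :: real
  defines "s1 \<equiv> 1 + \<delta>"
  defines "t \<equiv> max 0 (\<nu> - s1 * \<alpha>)" and "\<nu>1 \<equiv> max \<nu> (s1 * \<alpha>)"
  assumes \<nu>: "\<nu> \<ge> 0" and \<alpha>: "\<alpha> \<ge> 0" and e: "e > 0" and \<delta>: "0 < \<delta>" "\<delta> < 1"
    and s: "\<bar>s - 1\<bar> \<le> \<delta>"
    and lo: "- (s1 * \<alpha>) + (sqrt (t\<^sup>2 + 4 * (s1 * e)\<^sup>2) - t) / 2 + 2 * \<delta> * (\<alpha> + e) \<le> z"
    and hi: "z \<le> (s1 * \<alpha> - \<nu>1 + sqrt ((\<nu>1 + s1 * \<alpha>)\<^sup>2 + 4 * (s1 * e)\<^sup>2)) / 2 - 2 * \<delta> * (\<alpha> + e)"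
  shows "\<bar>\<nu> - soft (\<nu> + z) (s\<^sup>2 * e\<^sup>2)\<bar> \<le> s * \<alpha>"
proof -
  have s0: "s > 0" "s \<ge> 1 - \<delta>" "s \<le> s1" "s1 > 0" "0 < s * e" using s \<delta> e by (auto simp: s1_def abs_le_iff)
  have se: "s * \<alpha> \<ge> 0" "(1 - \<delta>) * \<alpha> \<le> s * \<alpha>" "s * \<alpha> \<le> s1 * \<alpha>" "s * e \<le> s1 * e"
    using s0 \<alpha> e by (auto intro: mult_right_mono)
  have "\<nu> - s * \<alpha> \<le> soft (\<nu> + z) ((s * e)\<^sup>2)"
  proof (cases "\<nu> \<le> s * \<alpha>")
    \<comment> \<open>The lower confidence limit is nonpositive here, so
      \<open>- (s * \<alpha>) \<le> z\<close> is enough; the margin turns \<open>s1\<close> into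
      \<open>1 - \<delta> \<le> s\<close>.\<close>
    case True
    have "0 \<le> sqrt (t\<^sup>2 + 4 * (s1 * e)\<^sup>2) - t" using real_sqrt_ge_abs1[of t "2 * (s1 * e)"]
      by (simp add: power_mult_distrib)
    then have "z \<ge> - (s1 * \<alpha>) + 2 * \<delta> * (\<alpha> + e)" using lo by argo
    also have "- (s1 * \<alpha>) + 2 * \<delta> * (\<alpha> + e) = - (1 - \<delta>) * \<alpha> + 2 * \<delta> * e" by (simp add: s1_def algebra_simps)
    finally have "- (1 - \<delta>) * \<alpha> + 2 * \<delta> * e \<le> z" .
    moreover have "- (1 - \<delta>) * \<alpha> = - ((1 - \<delta>) * \<alpha>)" by (rule minus_mult_left[symmetric])
    moreover have "0 \<le> 2 * \<delta> * e" using \<delta> e by simp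
    ultimately have "- (s * \<alpha>) \<le> z" using se by linarith
    then show ?thesis using True by (intro soft_ge_nonpos) auto
  next
    case False
    define x where "x = \<nu> - s * \<alpha>"
    have x: "x \<ge> 0" "t \<le> x" using False se by (auto simp: x_def t_def)
    have "sqrt (x\<^sup>2 + 4 * (s * e)\<^sup>2) - x \<le> sqrt (t\<^sup>2 + 4 * (s * e)\<^sup>2) - t"
      by (rule sqrt_add_sq_diff_antimono) fact
    also have "\<dots> \<le> sqrt (t\<^sup>2 + 4 * (s1 * e)\<^sup>2) - t"
      using se s0 by (simp add: power_mono)
    finally have "(sqrt (x\<^sup>2 + 4 * (s * e)\<^sup>2) - x) / 2 \<le> z + s1 * \<alpha> - 2 * \<delta> * (\<alpha> + e)"
      using lo by argo
    also have "\<dots> = z + (1 - \<delta>) * \<alpha> - 2 * \<delta> * e" by (simp add: s1_def algebra_simps)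
    also have "\<dots> \<le> z + s * \<alpha>"
    proof -
      have "0 \<le> 2 * \<delta> * e" using \<delta> e by simp
      then show ?thesis using se by linarith
    qed
    finally have "(x + sqrt (x\<^sup>2 + 4 * (s * e)\<^sup>2)) / 2 \<le> \<nu> + z" by (simp add: x_def field_simps)
    from soft_ge[OF s0(5) x(1) this] show ?thesis by (simp add: x_def)
  qed
  moreover have "soft (\<nu> + z) ((s * e)\<^sup>2) \<le> \<nu> + s * \<alpha>"
  proof (subst soft_le_iff)
    let ?R = "sqrt ((\<nu> + s * \<alpha>)\<^sup>2 + 4 * (s * e)\<^sup>2)"
    \<comment> \<open>First \<open>\<nu>1\<close> is replaced by \<open>\<nu>\<close>, then
      \<open>s1\<close> by \<open>s\<close> with the triangle inequality. The total loss
      \<open>2 * (s1 - s) * (\<alpha> + e)\<close> is covered by the margin because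
      \<open>s1 - s \<le> 2 * \<delta>\<close>.\<close>
    have "sqrt ((\<nu>1 + s1 * \<alpha>)\<^sup>2 + 4 * (s1 * e)\<^sup>2) - (\<nu>1 + s1 * \<alpha>)
        \<le> sqrt ((\<nu> + s1 * \<alpha>)\<^sup>2 + 4 * (s1 * e)\<^sup>2) - (\<nu> + s1 * \<alpha>)"
      by (rule sqrt_add_sq_diff_antimono) (simp add: \<nu>1_def)
    then have A: "2 * z + 4 * \<delta> * (\<alpha> + e) \<le> s1 * \<alpha> - \<nu> + sqrt ((\<nu> + s1 * \<alpha>)\<^sup>2 + 4 * (s1 * e)\<^sup>2)"
      using hi by argo
    have d: "0 \<le> (s1 - s) * \<alpha>" "0 \<le> (s1 - s) * e" using s0 \<alpha> e by auto
    have "sqrt ((\<nu> + s1 * \<alpha>)\<^sup>2 + 4 * (s1 * e)\<^sup>2)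
        = sqrt (((\<nu> + s * \<alpha>) + (s1 - s) * \<alpha>)\<^sup>2 + (2 * (s * e) + 2 * ((s1 - s) * e))\<^sup>2)"
      by (rule arg_cong[where f=sqrt]) (simp add: power2_eq_square algebra_simps)
    also have "\<dots> \<le> ?R + sqrt (((s1 - s) * \<alpha>)\<^sup>2 + (2 * ((s1 - s) * e))\<^sup>2)"
      using real_sqrt_sum_squares_triangle_ineq[of "\<nu> + s * \<alpha>" "(s1 - s) * \<alpha>" "2 * (s * e)" "2 * ((s1 - s) * e)"]
      by (simp add: power_mult_distrib)
    also have "sqrt (((s1 - s) * \<alpha>)\<^sup>2 + (2 * ((s1 - s) * e))\<^sup>2) \<le> (s1 - s) * \<alpha> + 2 * ((s1 - s) * e)"
      using d by (intro sqrt_sum_squares_le_sum) auto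
    finally have B: "sqrt ((\<nu> + s1 * \<alpha>)\<^sup>2 + 4 * (s1 * e)\<^sup>2) \<le> ?R + (s1 - s) * \<alpha> + 2 * ((s1 - s) * e)"
      by simp
    have "(s1 - s) * (\<alpha> + e) \<le> 2 * \<delta> * (\<alpha> + e)"
      using s0 \<alpha> e by (intro mult_right_mono) (auto simp: s1_def)
    then show "\<nu> + z \<le> (\<nu> + s * \<alpha> + ?R) / 2"
      using A B by (simp add: algebra_simps)
    show "s * e > 0" "0 \<le> \<nu> + s * \<alpha>" using s0 \<nu> se by auto
  qed
  ultimately show ?thesis by (simp add: abs_le_iff power_mult_distrib)
qed

text \<open>The extra \<open>\<delta>\<close> in \<open>\<nu>\<close> keeps the lower confidence
  limit strictly positive before shrinkage is undone: coverage forces a nonzero estimate, hence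
  \<open>s * e < \<nu> + z\<close>.\<close>

lemma soft_cover_only_if:
  fixes \<alpha> e \<delta> s z :: real
  defines "s1 \<equiv> 1 + \<delta>"
  defines "\<nu> \<equiv> s1 * \<alpha> + \<delta>"
  assumes \<alpha>: "\<alpha> \<ge> 0" and e: "e > 0" and \<delta>: "0 < \<delta>" "\<delta> < 1"
    and s: "\<bar>s - 1\<bar> \<le> \<delta>"
    and cov: "\<bar>\<nu> - soft (\<nu> + z) (s\<^sup>2 * e\<^sup>2)\<bar> \<le> s * \<alpha>"
  shows "(1 - \<delta>) * e - s1 * \<alpha> - \<delta> \<le> z" "z \<le> s1 * sqrt (\<alpha>\<^sup>2 + e\<^sup>2)"
proof -
  have s0: "s > 0" "s \<ge> 1 - \<delta>" "s \<le> s1" "s1 > 0" "0 < s * e" using s \<delta> e by (auto simp: s1_def abs_le_iff)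
  have se: "s * \<alpha> \<ge> 0" "(1 - \<delta>) * e \<le> s * e" "s * \<alpha> \<le> s1 * \<alpha>" "s * e \<le> s1 * e"
    using s0 \<alpha> e by (auto intro: mult_right_mono)
  have c: "\<nu> - s * \<alpha> \<le> soft (\<nu> + z) ((s * e)\<^sup>2)" "soft (\<nu> + z) ((s * e)\<^sup>2) \<le> \<nu> + s * \<alpha>"
    using cov by (auto simp: abs_le_iff power_mult_distrib)
  have "0 < soft (\<nu> + z) ((s * e)\<^sup>2)" using c(1) se \<delta> by (simp add: \<nu>_def)
  then have "s * e < \<nu> + z" using soft_nonpos[OF s0(5), of "\<nu> + z"] by linarith
  then show "(1 - \<delta>) * e - s1 * \<alpha> - \<delta> \<le> z" using se by (simp add: \<nu>_def)
  have "\<nu> \<ge> s1 * \<alpha>" using \<delta> by (simp add: \<nu>_def)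
  have n: "\<nu> \<ge> 0" using \<open>\<nu> \<ge> s1 * \<alpha>\<close> se by linarith
  have "\<nu> + z \<le> (\<nu> + s * \<alpha> + sqrt ((\<nu> + s * \<alpha>)\<^sup>2 + 4 * (s * e)\<^sup>2)) / 2"
    using c(2) by (subst (asm) soft_le_iff) (use s0 se n in auto)
  also have "\<dots> \<le> (\<nu> + s1 * \<alpha> + sqrt ((\<nu> + s1 * \<alpha>)\<^sup>2 + 4 * (s1 * e)\<^sup>2)) / 2"
    using se s0 n by (intro divide_right_mono add_mono real_sqrt_le_mono mult_left_mono power_mono) auto
  \<comment> \<open>Comparison with the value at \<open>\<nu> = s1 * \<alpha>\<close>, where the
    root becomes \<open>2 * s1 * sqrt (\<alpha>\<^sup>2 + e\<^sup>2)\<close>.\<close>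
  also have "\<dots> \<le> (\<nu> + s1 * \<alpha> + sqrt ((2 * s1 * \<alpha>)\<^sup>2 + 4 * (s1 * e)\<^sup>2) + (\<nu> + s1 * \<alpha> - 2 * s1 * \<alpha>)) / 2"
    using sqrt_add_sq_diff_antimono[of "2 * s1 * \<alpha>" "\<nu> + s1 * \<alpha>" "s1 * e"] \<open>\<nu> \<ge> s1 * \<alpha>\<close>
    by (intro divide_right_mono) linarith+
  also have "(2 * s1 * \<alpha>)\<^sup>2 + 4 * (s1 * e)\<^sup>2 = (2 * s1)\<^sup>2 * (\<alpha>\<^sup>2 + e\<^sup>2)"
    by (simp add: power2_eq_square algebra_simps)
  finally show "z \<le> s1 * sqrt (\<alpha>\<^sup>2 + e\<^sup>2)" using s0 by (simp add: real_sqrt_mult)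
qed

section \<open>The standard normal distribution function\<close>

abbreviation Phi :: "real \<Rightarrow> real" where "Phi \<equiv> cdf std_normal_distribution"

text \<open>Stated for an arbitrary antiderivative: it first helps to prove that \<open>Phi\<close>
  is one, and is then applied to \<open>Phi\<close> itself.\<close>

lemma measure_std_normal_Icc:
  assumes "a \<le> b" "\<And>x. DERIV G x :> std_normal_density x"
  shows "measure std_normal_distribution {a..b} = G b - G a"
proof -
  have "emeasure std_normal_distribution {a..b} = ennreal (G b - G a)"
    by (subst emeasure_density) (auto simp: nn_integral_FTC_Icc[OF _ assms(2) _ assms(1)])
  moreover have "G a \<le> G b"
    by (rule DERIV_nonneg_imp_nondecreasing[OF assms(1)]) (use assms(2) normal_density_nonneg in blast)
  ultimately show ?thesis by (simp add: measure_def)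
qed

text \<open>Continuity yields some antiderivative \<open>G\<close>. Interval probabilities show that
  \<open>Phi - G\<close> is constant; half-open and closed intervals agree because points are
  null.\<close>

lemma DERIV_Phi: "DERIV Phi x :> std_normal_density x"
proof -
  interpret N: real_distribution std_normal_distribution by (rule real_dist_normal_dist)
  have "\<exists>F. \<forall>x :: real. -\<infinity> < ereal x \<longrightarrow> ereal x < \<infinity> \<longrightarrow> (F has_vector_derivative std_normal_density x) (at x)"
    by (rule einterval_antiderivative) (auto simp: normal_density_def intro!: continuous_intros)
  then obtain G where G: "\<And>x. DERIV G x :> std_normal_density x"
    by (auto simp: has_real_derivative_iff_has_vector_derivative)
  have null: "measure std_normal_distribution {a} = 0" for a
    using measure_std_normal_Icc[OF order_refl G, of a] by simp
  have *: "Phi b - Phi a = G b - G a" if "a < b" for a b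
  proof -
    have "{a..b} = insert a {a<..b}" using that by auto
    then have "measure std_normal_distribution {a..b} = measure std_normal_distribution {a} + measure std_normal_distribution {a<..b}"
      using N.finite_measure_Union[of "{a}" "{a<..b}"] by auto
    then show ?thesis
      using N.cdf_diff_eq[OF that] measure_std_normal_Icc[OF _ G, of a b] that null by simp
  qed
  have "Phi y = G y + (Phi 0 - G 0)" for y
    using *[of 0 y] *[of y 0] by (cases y "0::real" rule: linorder_cases) auto
  then have "Phi = (\<lambda>y. G y + (Phi 0 - G 0))" by blast
  moreover have "DERIV (\<lambda>y. G y + (Phi 0 - G 0)) x :> std_normal_density x"
    using G[of x] by (auto intro!: derivative_eq_intros)
  ultimately show ?thesis by simp
qed

lemmas DERIV_Phi' = DERIV_chain2[OF DERIV_Phi]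

lemma Phi_mono: "x \<le> y \<Longrightarrow> Phi x \<le> Phi y"
  by (rule DERIV_nonneg_imp_nondecreasing[of x y Phi]) (use DERIV_Phi normal_density_nonneg in blast)+

section \<open>Density bounds and increments of the normal distribution function\<close>

lemma std_normal_density_le_1: "std_normal_density x \<le> 1"
proof -
  have "1 \<le> sqrt (2 * pi)" using pi_gt3 by (intro real_le_rsqrt) auto
  then have "1 / sqrt (2 * pi) \<le> 1" by simp
  moreover have "exp (- x\<^sup>2 / 2) \<le> 1" by simp
  ultimately show ?thesis unfolding std_normal_density_def by (intro mult_le_one) auto
qed

lemma std_normal_density_antimono:
  "\<bar>x\<bar> \<le> \<bar>y\<bar> \<Longrightarrow> std_normal_density y \<le> std_normal_density x"
  by (auto simp: std_normal_density_def abs_le_square_iff intro!: divide_right_mono)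

lemma mult_std_normal_density_half_le: "x * std_normal_density (x / 2) \<le> 1"
proof -
  \<comment> \<open>The density at \<open>x / 2\<close> carries the factor
    \<open>exp (- (x\<^sup>2 / 8))\<close>, so \<open>1 + t \<le> exp t\<close> at
    \<open>t = x\<^sup>2 / 8\<close> suffices.\<close>
  have "x \<le> 2 * (1 + x\<^sup>2 / 8)"
    using zero_le_power2[of "x - 2"] by (simp add: power2_eq_square algebra_simps)
  also have "\<dots> \<le> 2 * exp (x\<^sup>2 / 8)" by (intro mult_left_mono exp_ge_add_one_self) auto
  finally have "x * exp (- (x\<^sup>2 / 8)) \<le> 2" by (simp add: exp_minus field_simps)
  moreover have "2 \<le> sqrt (2 * pi)" using pi_gt3 by (intro real_le_rsqrt) auto
  ultimately have "x * exp (- (x\<^sup>2 / 8)) \<le> sqrt (2 * pi)" by linarith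
  then show ?thesis by (simp add: std_normal_density_def power_divide field_simps)
qed

text \<open>Mean value theorem. The bound \<open>B\<close> is required only between \<open>x\<close>
  and \<open>y\<close>, so that small tail densities can be exploited.\<close>

lemma Phi_diff_le:
  assumes "\<And>t. min x y \<le> t \<Longrightarrow> t \<le> max x y \<Longrightarrow> std_normal_density t \<le> B"
  shows "\<bar>Phi x - Phi y\<bar> \<le> B * \<bar>x - y\<bar>"
proof -
  have *: "\<bar>Phi a - Phi b\<bar> \<le> B * \<bar>a - b\<bar>" if ab: "a < b" "\<And>t. a \<le> t \<Longrightarrow> t \<le> b \<Longrightarrow> std_normal_density t \<le> B" for a b
  proof -
    obtain z where z: "a < z" "z < b" "Phi b - Phi a = (b - a) * std_normal_density z"
      using MVT2[OF ab(1) DERIV_Phi] by auto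
    have "(b - a) * std_normal_density z \<le> (b - a) * B"
      using ab z by (intro mult_left_mono) auto
    then show ?thesis using z Phi_mono[of a b] by (simp add: mult.commute)
  qed
  show ?thesis
  proof (cases x y rule: linorder_cases)
    case less then show ?thesis using *[of x y] assms by auto
  next
    case greater then show ?thesis using *[of y x] assms by (auto simp: abs_minus_commute)
  qed auto
qed

text \<open>The multiplicative part of the perturbation is harmless because \<open>x\<close> times
  the normal density at \<open>x / 2\<close> is bounded.\<close>
lemma Phi_perturb:
  assumes \<kappa>: "0 \<le> \<kappa>" "\<kappa> \<le> 1/2" and e: "0 \<le> e" and xy: "\<bar>x - y\<bar> \<le> \<kappa> * (\<bar>x\<bar> + e)"
  shows "\<bar>Phi x - Phi y\<bar> \<le> \<kappa> * (1 + e)"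
proof -
  \<comment> \<open>\<open>w\<close> splits the perturbation: \<open>x\<close> to \<open>w\<close>
    is the relative part, \<open>w\<close> to \<open>y\<close> the rest of size at most
    \<open>\<kappa> * e\<close>. As \<open>\<kappa> \<le> 1/2\<close>, the first segment stays at
    distance at least \<open>\<bar>x\<bar> / 2\<close> from 0.\<close>
  define w where "w = (if \<bar>x - y\<bar> \<le> \<kappa> * \<bar>x\<bar> then y else if x \<le> y then x + \<kappa> * \<bar>x\<bar> else x - \<kappa> * \<bar>x\<bar>)"
  have k: "0 \<le> \<kappa> * \<bar>x\<bar>" "\<kappa> * \<bar>x\<bar> \<le> \<bar>x\<bar> / 2" "0 \<le> \<kappa> * e"
    using \<kappa> e mult_right_mono[of \<kappa> "1/2" "\<bar>x\<bar>"] by auto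
  have w: "\<bar>x - w\<bar> \<le> \<kappa> * \<bar>x\<bar>" "\<bar>w - y\<bar> \<le> \<kappa> * e"
    using xy k by (auto simp: w_def distrib_left abs_le_iff)
  have "\<bar>Phi w - Phi y\<bar> \<le> 1 * \<bar>w - y\<bar>"
    by (rule Phi_diff_le) (rule std_normal_density_le_1)
  moreover have "\<bar>Phi x - Phi w\<bar> \<le> std_normal_density (\<bar>x\<bar> / 2) * \<bar>x - w\<bar>"
  proof (rule Phi_diff_le)
    fix t assume "min x w \<le> t" "t \<le> max x w"
    then have "\<bar>\<bar>x\<bar> / 2\<bar> \<le> \<bar>t\<bar>" using w k by (auto simp: abs_if split: if_splits)
    then show "std_normal_density t \<le> std_normal_density (\<bar>x\<bar> / 2)" by (rule std_normal_density_antimono)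
  qed
  moreover have "std_normal_density (\<bar>x\<bar> / 2) * \<bar>x - w\<bar> \<le> \<kappa>"
  proof -
    have "std_normal_density (\<bar>x\<bar> / 2) * \<bar>x - w\<bar> \<le> std_normal_density (\<bar>x\<bar> / 2) * (\<kappa> * \<bar>x\<bar>)"
      using w by (intro mult_left_mono) auto
    also have "\<dots> = \<kappa> * (\<bar>x\<bar> * std_normal_density (\<bar>x\<bar> / 2))" by simp
    also have "\<dots> \<le> \<kappa> * 1" using \<kappa> mult_std_normal_density_half_le by (intro mult_left_mono) auto
    finally show ?thesis by simp
  qed
  moreover have "\<bar>Phi x - Phi y\<bar> \<le> \<bar>Phi x - Phi w\<bar> + \<bar>Phi w - Phi y\<bar>" by simp
  ultimately have "\<bar>Phi x - Phi y\<bar> \<le> \<kappa> + \<kappa> * e" using w by linarith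
  then show ?thesis by (simp add: distrib_left)
qed

text \<open>As \<open>\<nu>\<close> grows beyond \<open>A\<close> the acceptance interval for \<open>Z\<close> moves left, its lower endpoint
  faster than its upper one; the upper endpoint has the larger modulus, hence the smaller density.\<close>
lemma coverage_mono:
  fixes A c \<nu> :: real
  assumes A: "0 \<le> A" and c: "0 < c" and \<nu>: "A \<le> \<nu>"
  shows "Phi (sqrt (A\<^sup>2 + c\<^sup>2)) - Phi (c - A)
    \<le> Phi ((A - \<nu> + sqrt ((\<nu> + A)\<^sup>2 + 4 * c\<^sup>2)) / 2) - Phi (- A + (sqrt ((\<nu> - A)\<^sup>2 + 4 * c\<^sup>2) - (\<nu> - A)) / 2)"
proof -
  define u where "u = (\<lambda>t. (A - t + sqrt ((t + A)\<^sup>2 + 4 * c\<^sup>2)) / 2)"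
  define l where "l = (\<lambda>t. - A + (sqrt ((t - A)\<^sup>2 + 4 * c\<^sup>2) - (t - A)) / 2)"
  define u' where "u' = (\<lambda>t. ((t + A) / sqrt ((t + A)\<^sup>2 + 4 * c\<^sup>2) - 1) / 2)"
  define l' where "l' = (\<lambda>t. ((t - A) / sqrt ((t - A)\<^sup>2 + 4 * c\<^sup>2) - 1) / 2)"
  have pos: "0 < x\<^sup>2 + 4 * c\<^sup>2" for x :: real using c by (simp add: add_nonneg_pos)
  have du: "(u has_real_derivative u' t) (at t)" for t
    unfolding u_def u'_def using pos[of "t + A"]
    by (auto intro!: derivative_eq_intros simp: field_simps)
  have dl: "(l has_real_derivative l' t) (at t)" for t
    unfolding l_def l'_def using pos[of "t - A"]
    by (auto intro!: derivative_eq_intros simp: field_simps)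
  have "Phi (u A) - Phi (l A) \<le> Phi (u \<nu>) - Phi (l \<nu>)"
  proof (rule DERIV_nonneg_imp_nondecreasing[OF \<nu>])
    fix t assume t: "A \<le> t" "t \<le> \<nu>"
    define p q where "p = sqrt ((t + A)\<^sup>2 + 4 * c\<^sup>2)" and "q = sqrt ((t - A)\<^sup>2 + 4 * c\<^sup>2)"
    have pq: "q \<le> p" "0 < p" "0 < q" using t A pos by (auto simp: p_def q_def intro!: power_mono)
    have pq2: "p\<^sup>2 = (t + A)\<^sup>2 + 4 * c\<^sup>2" "q\<^sup>2 = (t - A)\<^sup>2 + 4 * c\<^sup>2" using pos by (auto simp: p_def q_def less_imp_le)
    have pt: "t + A \<le> p" "t - A \<le> q" by (auto simp: p_def q_def intro!: real_le_rsqrt)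
    have "u t + l t \<ge> 0" "l t \<le> u t" using pt pq t A unfolding u_def l_def p_def[symmetric] q_def[symmetric] by argo+
    then have "\<bar>l t\<bar> \<le> \<bar>u t\<bar>" by linarith
    then have phi: "std_normal_density (u t) \<le> std_normal_density (l t)" by (rule std_normal_density_antimono)
    \<comment> \<open>This is \<open>l' t \<le> u' t\<close>: the map from \<open>x\<close> to
      \<open>x / sqrt (x\<^sup>2 + 4 * c\<^sup>2)\<close> is increasing, verified here by comparing
      squares.\<close>
    have "(t - A) / q \<le> (t + A) / p"
    proof -
      have "((t - A) * p)\<^sup>2 \<le> ((t + A) * q)\<^sup>2"
      proof -
        have "((t + A) * q)\<^sup>2 - ((t - A) * p)\<^sup>2 = 4 * c\<^sup>2 * (4 * t * A)"
          unfolding power_mult_distrib pq2 by (simp add: power2_eq_square algebra_simps)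
        also have "\<dots> \<ge> 0" using t A by (intro mult_nonneg_nonneg) auto
        finally show ?thesis by simp
      qed
      then have "(t - A) * p \<le> (t + A) * q" by (rule power2_le_imp_le) (use t A pq in auto)
      then show ?thesis using pq by (simp add: field_simps)
    qed
    then have "l' t \<le> u' t" unfolding l'_def u'_def p_def q_def by argo
    moreover have "u' t \<le> 0" using pt pq by (simp add: u'_def p_def[symmetric])
    ultimately have "std_normal_density (l t) * (- u' t) \<le> std_normal_density (l t) * (- l' t)"
      by (intro mult_left_mono) auto
    moreover have "std_normal_density (u t) * (- u' t) \<le> std_normal_density (l t) * (- u' t)"
      using phi \<open>u' t \<le> 0\<close> by (intro mult_right_mono) auto
    ultimately have "0 \<le> std_normal_density (u t) * u' t - std_normal_density (l t) * l' t" by simp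
    then show "\<exists>y. ((\<lambda>t. Phi (u t) - Phi (l t)) has_real_derivative y) (at t) \<and> 0 \<le> y"
      using DERIV_diff[OF DERIV_Phi'[OF du] DERIV_Phi'[OF dl]] by blast
  qed
  moreover have "u A = sqrt (A\<^sup>2 + c\<^sup>2)"
  proof -
    have "(A + A)\<^sup>2 + 4 * c\<^sup>2 = 2\<^sup>2 * (A\<^sup>2 + c\<^sup>2)" by (simp add: power2_eq_square)
    then show ?thesis unfolding u_def by (simp only: real_sqrt_mult) simp
  qed
  moreover have "l A = c - A" using c by (simp add: l_def real_sqrt_mult)
  ultimately show ?thesis by (simp add: u_def l_def)
qed

section \<open>Infimal coverage\<close>

text \<open>The infimum over \<open>\<nu>\<close> of the known-variance coverage; it is not attained but is the limit from
  the right at \<open>\<nu> = \<alpha>\<close>, which is why \<open>coverage_upper\<close> takes \<open>\<nu>\<close> slightly above \<open>\<alpha>\<close>.\<close>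
definition min_cover :: "real \<Rightarrow> real \<Rightarrow> real" where
  "min_cover \<alpha> e = Phi (sqrt (\<alpha>\<^sup>2 + e\<^sup>2)) - Phi (e - \<alpha>)"

section \<open>Coverage probabilities up to explicit errors\<close>

lemma borel_measurable_soft [measurable (raw)]:
  "f \<in> borel_measurable M \<Longrightarrow> g \<in> borel_measurable M \<Longrightarrow> (\<lambda>x. soft (f x) (g x)) \<in> borel_measurable M"
  unfolding soft_def by (intro borel_measurable_times borel_measurable_max borel_measurable_diff
    borel_measurable_divide borel_measurable_power) auto

text \<open>The maximum accounts for \<open>b < a\<close>: endpoints shifted by error margins need
  not stay ordered.\<close>

lemma (in prob_space) prob_std_normal_Icc:
  assumes "distributed M lborel Z std_normal_density"
  shows "prob {x \<in> space M. a \<le> Z x \<and> Z x \<le> b} = max 0 (Phi b - Phi a)"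
proof -
  have Z: "Z \<in> borel_measurable M" and D: "distr M lborel Z = std_normal_distribution"
    using distributed_measurable[OF assms] distributed_distr_eq_density[OF assms] by auto
  have "prob {x \<in> space M. a \<le> Z x \<and> Z x \<le> b} = measure (distr M lborel Z) {a..b}"
    using Z by (subst measure_distr) (auto intro!: arg_cong[where f=prob])
  also have "\<dots> = max 0 (Phi b - Phi a)"
  proof (cases "a \<le> b")
    case True
    then show ?thesis unfolding D using measure_std_normal_Icc[OF True DERIV_Phi] Phi_mono[OF True] by simp
  next
    case False
    then show ?thesis using Phi_mono[of b a] by simp
  qed
  finally show ?thesis .
qed

text \<open>Both arguments of \<open>Phi\<close> in \<open>min_cover\<close> are homogeneous, so
  scaling is a purely relative perturbation and costs at most \<open>\<delta>\<close> at
  each.\<close>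

lemma min_cover_scale:
  assumes "\<alpha> \<ge> 0" "0 \<le> \<delta>" "\<delta> \<le> 1/2"
  shows "min_cover \<alpha> e - 2 * \<delta> \<le> min_cover ((1 + \<delta>) * \<alpha>) ((1 + \<delta>) * e)"
proof -
  have *: "\<bar>Phi x - Phi ((1 + \<delta>) * x)\<bar> \<le> \<delta>" for x
    using Phi_perturb[of \<delta> 0 x "(1 + \<delta>) * x"] assms by (simp add: distrib_right abs_mult)
  have "((1 + \<delta>) * \<alpha>)\<^sup>2 + ((1 + \<delta>) * e)\<^sup>2 = (1 + \<delta>)\<^sup>2 * (\<alpha>\<^sup>2 + e\<^sup>2)"
    by (simp add: power2_eq_square algebra_simps)
  then have eq: "sqrt (((1 + \<delta>) * \<alpha>)\<^sup>2 + ((1 + \<delta>) * e)\<^sup>2) = (1 + \<delta>) * sqrt (\<alpha>\<^sup>2 + e\<^sup>2)"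
    using assms by (simp add: real_sqrt_mult)
  show ?thesis
    using abs_le_D1[OF *[of "sqrt (\<alpha>\<^sup>2 + e\<^sup>2)"]] abs_le_D2[OF *[of "e - \<alpha>"]]
    unfolding min_cover_def eq right_diff_distrib[symmetric] by linarith
qed

text \<open>Outside the event that \<open>S\<close> is far from 1, \<open>soft_cover_if\<close>
  applies. \<open>Phi_perturb\<close> then removes the margins, \<open>coverage_mono\<close> moves
  \<open>\<nu>1\<close> to its worst value, and \<open>min_cover_scale\<close> removes
  \<open>s1\<close>.\<close>

lemma (in prob_space) coverage_lower_nonneg:
  assumes Z: "distributed M lborel Z std_normal_density" and S [measurable]: "S \<in> borel_measurable M"
    and \<epsilon>: "prob {x \<in> space M. \<delta> < \<bar>S x - 1\<bar>} \<le> \<epsilon>"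
    and \<alpha>: "\<alpha> \<ge> 0" and e: "e > 0" and \<delta>: "0 < \<delta>" "\<delta> \<le> 1/12" and \<nu>: "\<nu> \<ge> 0"
  shows "min_cover \<alpha> e - \<epsilon> - 10 * \<delta> * (1 + e)
    \<le> prob {x \<in> space M. \<bar>\<nu> - soft (\<nu> + Z x) ((S x)\<^sup>2 * e\<^sup>2)\<bar> \<le> S x * \<alpha>}"
proof -
  have [measurable]: "Z \<in> borel_measurable M" using distributed_measurable[OF Z] by simp
  define s1 t \<nu>1 where "s1 = 1 + \<delta>" and "t = max 0 (\<nu> - s1 * \<alpha>)" and "\<nu>1 = max \<nu> (s1 * \<alpha>)"
  define l where "l = - (s1 * \<alpha>) + (sqrt (t\<^sup>2 + 4 * (s1 * e)\<^sup>2) - t) / 2"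
  define u where "u = (s1 * \<alpha> - \<nu>1 + sqrt ((\<nu>1 + s1 * \<alpha>)\<^sup>2 + 4 * (s1 * e)\<^sup>2)) / 2"
  define d where "d = 2 * \<delta> * (\<alpha> + e)"
  have s1: "1 \<le> s1" "s1 \<le> 2" using \<delta> by (auto simp: s1_def)
  have a1: "\<alpha> \<le> s1 * \<alpha>" "e \<le> s1 * e" "s1 * e \<le> 2 * e" "0 \<le> s1 * \<alpha>" "0 < s1 * e"
    using s1 \<alpha> e by (auto simp: mult_le_cancel_right1)
  have "prob {x \<in> space M. l + d \<le> Z x \<and> Z x \<le> u - d}
      \<le> prob ({x \<in> space M. \<bar>\<nu> - soft (\<nu> + Z x) ((S x)\<^sup>2 * e\<^sup>2)\<bar> \<le> S x * \<alpha>} \<union> {x \<in> space M. \<delta> < \<bar>S x - 1\<bar>})"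
  proof (rule finite_measure_mono)
    show "{x \<in> space M. l + d \<le> Z x \<and> Z x \<le> u - d} \<subseteq>
      {x \<in> space M. \<bar>\<nu> - soft (\<nu> + Z x) ((S x)\<^sup>2 * e\<^sup>2)\<bar> \<le> S x * \<alpha>} \<union> {x \<in> space M. \<delta> < \<bar>S x - 1\<bar>}"
      using soft_cover_if[OF \<nu> \<alpha> e \<delta>(1)] \<delta>
      by (auto simp: l_def u_def d_def s1_def t_def \<nu>1_def not_less)
  qed measurable
  also have "\<dots> \<le> prob {x \<in> space M. \<bar>\<nu> - soft (\<nu> + Z x) ((S x)\<^sup>2 * e\<^sup>2)\<bar> \<le> S x * \<alpha>} + \<epsilon>"
    using \<epsilon> by (intro order_trans[OF measure_Un_le] add_left_mono) auto
  finally have 1: "Phi (u - d) - Phi (l + d) - \<epsilon>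
      \<le> prob {x \<in> space M. \<bar>\<nu> - soft (\<nu> + Z x) ((S x)\<^sup>2 * e\<^sup>2)\<bar> \<le> S x * \<alpha>}"
    unfolding prob_std_normal_Icc[OF Z] by simp
  have t: "t = \<nu>1 - s1 * \<alpha>" by (auto simp: t_def \<nu>1_def)
  have d0: "0 \<le> d" using \<alpha> e \<delta> by (simp add: d_def)
  have "\<nu>1 + s1 * \<alpha> \<le> sqrt ((\<nu>1 + s1 * \<alpha>)\<^sup>2 + 4 * (s1 * e)\<^sup>2)" by (rule real_le_rsqrt) simp
  then have "\<alpha> \<le> \<bar>u\<bar>" using a1 by (simp add: u_def)
  then have "d \<le> 2 * \<delta> * (\<bar>u\<bar> + e)" using \<delta> by (auto simp: d_def)
  then have 2: "\<bar>Phi u - Phi (u - d)\<bar> \<le> 2 * \<delta> * (1 + e)"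
    using \<delta> e d0 by (intro Phi_perturb) auto
  \<comment> \<open>A large \<open>\<alpha>\<close> forces \<open>l\<close> far below 0, which
    bounds \<open>d\<close> by \<open>6 * \<delta> * (\<bar>l\<bar> + e)\<close>.
    \<open>Phi_perturb\<close> needs \<open>6 * \<delta> \<le> 1/2\<close>, whence the assumption
    \<open>\<delta> \<le> 1/12\<close>.\<close>
  have "sqrt (t\<^sup>2 + 4 * (s1 * e)\<^sup>2) - t \<le> sqrt (0\<^sup>2 + 4 * (s1 * e)\<^sup>2) - 0"
    by (rule sqrt_add_sq_diff_antimono) (simp add: t_def)
  then have "l \<le> s1 * e - s1 * \<alpha>" using a1 e by (simp add: l_def real_sqrt_mult)
  then have "\<alpha> \<le> \<bar>l\<bar> + 2 * e" using a1 by linarith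
  then have "\<alpha> + e \<le> 3 * (\<bar>l\<bar> + e)" by simp
  then have "2 * \<delta> * (\<alpha> + e) \<le> 2 * \<delta> * (3 * (\<bar>l\<bar> + e))" using \<delta> by (intro mult_left_mono) auto
  then have "d \<le> 6 * \<delta> * (\<bar>l\<bar> + e)" by (simp add: d_def mult_ac)
  then have 3: "\<bar>Phi l - Phi (l + d)\<bar> \<le> 6 * \<delta> * (1 + e)"
    using \<delta> e d0 by (intro Phi_perturb) auto
  have "min_cover (s1 * \<alpha>) (s1 * e) \<le> Phi u - Phi l"
    using coverage_mono[of "s1 * \<alpha>" "s1 * e" \<nu>1] a1 unfolding min_cover_def u_def l_def t by (simp add: \<nu>1_def)
  moreover have "min_cover \<alpha> e - 2 * \<delta> \<le> min_cover (s1 * \<alpha>) (s1 * e)"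
    unfolding s1_def by (rule min_cover_scale) (use \<alpha> \<delta> in auto)
  \<comment> \<open>The losses at \<open>u\<close>, at \<open>l\<close> and from scaling add up to
    the constant 2 + 6 + 2 = 10.\<close>
  moreover have "2 * \<delta> \<le> 2 * \<delta> * (1 + e)" using \<delta> e by simp
  ultimately show ?thesis using 1 2 3 unfolding abs_le_iff by (simp add: algebra_simps)
qed

text \<open>Reflection: \<open>soft\<close> is odd and \<open>- Z\<close> is again standard
  normal.\<close>

lemma (in prob_space) coverage_lower:
  assumes Z: "distributed M lborel Z std_normal_density" and S: "S \<in> borel_measurable M"
    and \<epsilon>: "prob {x \<in> space M. \<delta> < \<bar>S x - 1\<bar>} \<le> \<epsilon>"
    and \<alpha>: "\<alpha> \<ge> 0" and e: "e > 0" and \<delta>: "0 < \<delta>" "\<delta> \<le> 1/12"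
  shows "min_cover \<alpha> e - \<epsilon> - 10 * \<delta> * (1 + e)
    \<le> prob {x \<in> space M. \<bar>\<nu> - soft (\<nu> + Z x) ((S x)\<^sup>2 * e\<^sup>2)\<bar> \<le> S x * \<alpha>}"
proof (cases "\<nu> \<ge> 0")
  case True
  then show ?thesis by (rule coverage_lower_nonneg[OF assms])
next
  case False
  have "distributed M lborel (\<lambda>x. - Z x) std_normal_density"
    using normal_density_affine[OF Z, of "-1" 0] by simp
  from coverage_lower_nonneg[OF this S \<epsilon> \<alpha> e \<delta>, of "- \<nu>"] False
  have "min_cover \<alpha> e - \<epsilon> - 10 * \<delta> * (1 + e)
    \<le> prob {x \<in> space M. \<bar>- \<nu> - soft (- (\<nu> + Z x)) ((S x)\<^sup>2 * e\<^sup>2)\<bar> \<le> S x * \<alpha>}" by simp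
  also have "(\<lambda>x. \<bar>- \<nu> - soft (- (\<nu> + Z x)) ((S x)\<^sup>2 * e\<^sup>2)\<bar>) = (\<lambda>x. \<bar>\<nu> - soft (\<nu> + Z x) ((S x)\<^sup>2 * e\<^sup>2)\<bar>)"
    unfolding soft_minus by (auto simp: abs_if)
  finally show ?thesis by meson
qed

lemma (in prob_space) coverage_upper:
  assumes Z: "distributed M lborel Z std_normal_density" and S [measurable]: "S \<in> borel_measurable M"
    and \<epsilon>: "prob {x \<in> space M. \<delta> < \<bar>S x - 1\<bar>} \<le> \<epsilon>"
    and \<alpha>: "\<alpha> \<ge> 0" and e: "e > 0" and \<delta>: "0 < \<delta>" "\<delta> \<le> 1/12"
    and \<nu>: "\<nu> = (1 + \<delta>) * \<alpha> + \<delta>"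
  shows "prob {x \<in> space M. \<bar>\<nu> - soft (\<nu> + Z x) ((S x)\<^sup>2 * e\<^sup>2)\<bar> \<le> S x * \<alpha>}
    \<le> min_cover \<alpha> e + \<epsilon> + 10 * \<delta> * (1 + e)"
proof -
  have [measurable]: "Z \<in> borel_measurable M" using distributed_measurable[OF Z] by simp
  define l where "l = (1 - \<delta>) * e - (1 + \<delta>) * \<alpha> - \<delta>"
  define w where "w = sqrt (\<alpha>\<^sup>2 + e\<^sup>2)"
  have "prob {x \<in> space M. \<bar>\<nu> - soft (\<nu> + Z x) ((S x)\<^sup>2 * e\<^sup>2)\<bar> \<le> S x * \<alpha>}
      \<le> prob ({x \<in> space M. l \<le> Z x \<and> Z x \<le> (1 + \<delta>) * w} \<union> {x \<in> space M. \<delta> < \<bar>S x - 1\<bar>})"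
  proof (rule finite_measure_mono)
    show "{x \<in> space M. \<bar>\<nu> - soft (\<nu> + Z x) ((S x)\<^sup>2 * e\<^sup>2)\<bar> \<le> S x * \<alpha>} \<subseteq>
       {x \<in> space M. l \<le> Z x \<and> Z x \<le> (1 + \<delta>) * w} \<union> {x \<in> space M. \<delta> < \<bar>S x - 1\<bar>}"
      using soft_cover_only_if[OF \<alpha> e \<delta>(1)] \<delta> by (auto simp: l_def w_def \<nu> not_less)
  qed measurable
  also have "\<dots> \<le> max 0 (Phi ((1 + \<delta>) * w) - Phi l) + \<epsilon>"
    using \<epsilon> by (intro order_trans[OF measure_Un_le] add_mono) (auto simp: prob_std_normal_Icc[OF Z])
  finally have 1: "prob {x \<in> space M. \<bar>\<nu> - soft (\<nu> + Z x) ((S x)\<^sup>2 * e\<^sup>2)\<bar> \<le> S x * \<alpha>}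
      \<le> max 0 (Phi ((1 + \<delta>) * w) - Phi l) + \<epsilon>" .
  have 2: "\<bar>Phi w - Phi ((1 + \<delta>) * w)\<bar> \<le> \<delta>"
    using Phi_perturb[of \<delta> 0 w "(1 + \<delta>) * w"] \<delta> by (simp add: distrib_right abs_mult)
  \<comment> \<open>The additive \<open>\<delta>\<close> in \<open>l\<close> is not proportional to
    \<open>\<alpha>\<close> or \<open>e\<close>; using \<open>e + 1\<close> in place of
    \<open>e\<close> absorbs it.\<close>
  have 3: "\<bar>Phi (e - \<alpha>) - Phi l\<bar> \<le> 2 * \<delta> * (1 + (e + 1))"
  proof (rule Phi_perturb)
    have "e - \<alpha> - l = \<delta> * (e + \<alpha> + 1)" by (simp add: l_def algebra_simps)
    then have "\<bar>e - \<alpha> - l\<bar> = \<delta> * (e + \<alpha> + 1)" using \<alpha> e \<delta> by simp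
    also have "\<dots> \<le> \<delta> * (2 * (\<bar>e - \<alpha>\<bar> + (e + 1)))"
    proof (rule mult_left_mono)
      show "e + \<alpha> + 1 \<le> 2 * (\<bar>e - \<alpha>\<bar> + (e + 1))"
        using e abs_ge_minus_self[of "e - \<alpha>"] abs_ge_zero[of "e - \<alpha>"] by argo
    qed (use \<delta> in simp)
    finally show "\<bar>e - \<alpha> - l\<bar> \<le> 2 * \<delta> * (\<bar>e - \<alpha>\<bar> + (e + 1))" by (simp only: mult_ac)
  qed (use \<delta> e in auto)
  have "Phi ((1 + \<delta>) * w) - Phi l \<le> min_cover \<alpha> e + (5 * \<delta> + 2 * (\<delta> * e))"
    using 2 3 unfolding abs_le_iff min_cover_def w_def by (simp add: algebra_simps)
  moreover have "0 < \<delta> * e" using \<delta> e by simp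
  \<comment> \<open>Nonnegativity disposes of the \<open>max 0\<close> in the probability
    bound.\<close>
  moreover have "0 \<le> min_cover \<alpha> e"
  proof -
    have "\<bar>e\<bar> \<le> sqrt (\<alpha>\<^sup>2 + e\<^sup>2)" by simp
    then have "e - \<alpha> \<le> sqrt (\<alpha>\<^sup>2 + e\<^sup>2)" using \<alpha> by linarith
    then show ?thesis by (simp add: min_cover_def Phi_mono)
  qed
  ultimately show ?thesis using 1 \<delta> by (simp add: algebra_simps)
qed

section \<open>Linear and quadratic forms in Gaussian noise\<close>

definition gauss_moment :: "nat \<Rightarrow> real" where
  "gauss_moment p = (\<integral>x. std_normal_density x * x ^ p \<partial>lborel)"

lemma gauss_moment_simps [simp]:
  "gauss_moment 0 = 1" "gauss_moment (Suc 0) = 0" "gauss_moment 2 = 1"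
  "gauss_moment 3 = 0" "gauss_moment 4 = 3"
  using integral_std_normal_moment_even[of 0] integral_std_normal_moment_odd[of 0]
    integral_std_normal_moment_even[of 1] integral_std_normal_moment_odd[of 1]
    integral_std_normal_moment_even[of 2]
  by (auto simp: gauss_moment_def eval_nat_numeral fact_numeral)

lemma sum_mult_of_bool:
  fixes f :: "nat \<Rightarrow> real"
  shows "k < n \<Longrightarrow> (\<Sum>l<n. f l * of_bool (k = l)) = f k"
  by (simp add: of_bool_def if_distrib[of "\<lambda>x. f _ * x"] cong: if_cong)

text \<open>The means are carried along so that \<open>M\<close> is literally the law of the
  observations, while \<open>u\<close> recovers the standardised noise.\<close>

locale gauss_sample =
  fixes n :: nat and \<mu> :: "nat \<Rightarrow> real" and \<sigma> :: real
  assumes \<sigma>_pos: "0 < \<sigma>"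
begin

abbreviation N :: "nat \<Rightarrow> real measure" where
  "N j \<equiv> density lborel (normal_density (\<mu> j) \<sigma>)"

definition M :: "(nat \<Rightarrow> real) measure" where
  "M = PiM {..<n} N"

definition u :: "nat \<Rightarrow> (nat \<Rightarrow> real) \<Rightarrow> real" where
  "u j y = (y j - \<mu> j) / \<sigma>"

lemma prob_space_N: "prob_space (N j)"
  by (rule prob_space_normal_density[OF \<sigma>_pos])

lemma product_prob_space_N: "product_prob_space N"
  by (intro product_prob_spaceI prob_space_N)

sublocale prob_space M
  unfolding M_def by (intro prob_space_PiM prob_space_N)

lemma sets_M: "sets M = sets (PiM {..<n} (\<lambda>_. borel))"
  unfolding M_def by (intro sets_PiM_cong) auto

lemma measurable_component [measurable]: "j < n \<Longrightarrow> (\<lambda>y. y j) \<in> borel_measurable M"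
  unfolding measurable_cong_sets[OF sets_M refl] by measurable

lemma measurable_u [measurable]: "j < n \<Longrightarrow> u j \<in> borel_measurable M"
  unfolding u_def[abs_def] by measurable

section \<open>Moments of the standardised noise\<close>

lemma N_moment:
  "has_bochner_integral (N j) (\<lambda>x. ((x - \<mu> j) / \<sigma>) ^ p) (gauss_moment p)"
proof -
  interpret N: prob_space "N j" by (rule prob_space_N)
  have "distributed (N j) lborel (\<lambda>x. x) (normal_density (\<mu> j) \<sigma>)"
    unfolding distributed_def by (auto simp: distr_id2)
  then have D: "distributed (N j) lborel (\<lambda>x. (x - \<mu> j) / \<sigma>) std_normal_density"
    by (rule iffD1[OF N.normal_standard_normal_convert[OF \<sigma>_pos]])
  have "integrable (N j) (\<lambda>x. ((x - \<mu> j) / \<sigma>) ^ p)"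
    using distributed_integrable[OF D, of "\<lambda>x. x ^ p"] integrable_std_normal_moment[of p] by simp
  moreover have "(\<integral>x. ((x - \<mu> j) / \<sigma>) ^ p \<partial>N j) = gauss_moment p"
    using distributed_integral[OF D, of "\<lambda>x. x ^ p"] by (simp add: gauss_moment_def)
  ultimately show ?thesis by (simp add: has_bochner_integral_iff)
qed

lemma moment_prod:
  "has_bochner_integral M (\<lambda>y. \<Prod>t<n. u t y ^ p t) (\<Prod>t<n. gauss_moment (p t))"
proof -
  interpret P: product_prob_space N by (rule product_prob_space_N)
  have i: "integrable (N t) (\<lambda>x. ((x - \<mu> t) / \<sigma>) ^ p t)" "(\<integral>x. ((x - \<mu> t) / \<sigma>) ^ p t \<partial>N t) = gauss_moment (p t)" for t
    using N_moment[of t "p t"] by (auto simp: has_bochner_integral_iff)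
  show ?thesis
    unfolding has_bochner_integral_iff M_def u_def
    using P.product_integrable_prod[of "{..<n}" "\<lambda>t x. ((x - \<mu> t) / \<sigma>) ^ p t"]
      P.product_integral_prod[of "{..<n}" "\<lambda>t x. ((x - \<mu> t) / \<sigma>) ^ p t"] i
    by simp
qed

lemma prod_pow_of_bool: "i < n \<Longrightarrow> (\<Prod>t<n. f t ^ of_bool (t = i)) = (f i :: real)"
  by (simp add: of_bool_def if_distrib[of "\<lambda>k. _ ^ k"] cong: if_cong)

text \<open>The exponent of \<open>u t\<close> counts the occurrences of \<open>t\<close> among the
  indices; coordinates that do not occur contribute \<open>gauss_moment 0 = 1\<close>.\<close>

lemma isserlis2:
  assumes "i < n" "j < n"
  shows "has_bochner_integral M (\<lambda>y. u i y * u j y) (of_bool (i = j))"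
proof -
  let ?p = "\<lambda>t. of_bool (t = i) + of_bool (t = j) :: nat"
  have "(\<Prod>t<n. u t y ^ ?p t) = u i y * u j y" for y
    using assms by (simp add: power_add prod.distrib prod_pow_of_bool)
  moreover have "(\<Prod>t<n. gauss_moment (?p t)) = (\<Prod>t\<in>{i, j}. gauss_moment (?p t))"
    using assms by (intro prod.mono_neutral_right) auto
  moreover have "\<dots> = of_bool (i = j)" by (cases "i = j") (auto simp: numeral_2_eq_2[symmetric])
  ultimately show ?thesis using moment_prod[of ?p] by simp
qed

text \<open>Wick's formula: an index of odd multiplicity makes the moment vanish, and four equal
  indices give 3, one for each pairing.\<close>

lemma isserlis4:
  assumes "i < n" "j < n" "k < n" "l < n"
  shows "has_bochner_integral M (\<lambda>y. u i y * u j y * (u k y * u l y))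
    (of_bool (i = j) * of_bool (k = l) + of_bool (i = k) * of_bool (j = l) + of_bool (i = l) * of_bool (j = k))"
proof -
  let ?p = "\<lambda>t. of_bool (t = i) + of_bool (t = j) + of_bool (t = k) + of_bool (t = l) :: nat"
  have "(\<Prod>t<n. u t y ^ ?p t) = u i y * u j y * (u k y * u l y)" for y
    using assms by (simp add: power_add prod.distrib prod_pow_of_bool)
  moreover have "(\<Prod>t<n. gauss_moment (?p t)) = (\<Prod>t\<in>{i, j, k, l}. gauss_moment (?p t))"
    using assms by (intro prod.mono_neutral_right) auto
  moreover have "\<dots> = of_bool (i = j) * of_bool (k = l) + of_bool (i = k) * of_bool (j = l) + of_bool (i = l) * of_bool (j = k)"
    by (cases "i = j"; cases "i = k"; cases "i = l"; cases "j = k"; cases "j = l"; cases "k = l")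
      (simp_all add: insert_commute flip: numeral_2_eq_2 numeral_3_eq_3)
  ultimately show ?thesis using moment_prod[of ?p] by simp
qed

text \<open>Chebyshev's inequality. In the second moment the first pairing gives the squared trace;
  the other two each give the sum of squared entries, by symmetry, and together form the
  variance.\<close>

lemma quadratic_form_deviation:
  fixes A :: "nat \<Rightarrow> nat \<Rightarrow> real"
  assumes sym: "\<And>i j. i < n \<Longrightarrow> j < n \<Longrightarrow> A i j = A j i" and t: "0 < t"
  shows "prob {y \<in> space M. t \<le> \<bar>(\<Sum>i<n. \<Sum>j<n. A i j * (u i y * u j y)) - (\<Sum>i<n. A i i)\<bar>}
    \<le> 2 * (\<Sum>i<n. \<Sum>j<n. (A i j)\<^sup>2) / t\<^sup>2"
proof -
  define Q where "Q = (\<lambda>y. \<Sum>i<n. \<Sum>j<n. A i j * (u i y * u j y))"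
  have [measurable]: "Q \<in> borel_measurable M" unfolding Q_def by measurable
  have "has_bochner_integral M Q (\<Sum>i<n. \<Sum>j<n. A i j * of_bool (i = j))"
    unfolding Q_def by (intro has_bochner_integral_sum has_bochner_integral_mult_right isserlis2) auto
  also have "(\<Sum>i<n. \<Sum>j<n. A i j * of_bool (i = j)) = (\<Sum>i<n. A i i)"
    by (simp add: of_bool_def if_distrib cong: if_cong)
  finally have EQ: "has_bochner_integral M Q (\<Sum>i<n. A i i)" .
  have Q2: "(\<lambda>y. (Q y)\<^sup>2) = (\<lambda>y. \<Sum>i<n. \<Sum>j<n. \<Sum>k<n. \<Sum>l<n. A i j * A k l * (u i y * u j y * (u k y * u l y)))"
    unfolding Q_def power2_eq_square
    by (simp only: sum_distrib_right) (simp only: sum_distrib_left mult_ac)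
  let ?E = "\<Sum>i<n. \<Sum>j<n. \<Sum>k<n. \<Sum>l<n. A i j * A k l *
    (of_bool (i = j) * of_bool (k = l) + of_bool (i = k) * of_bool (j = l) + of_bool (i = l) * of_bool (j = k))"
  have EQ2: "has_bochner_integral M (\<lambda>y. (Q y)\<^sup>2) ?E"
    unfolding Q2 by (intro has_bochner_integral_sum has_bochner_integral_mult_right isserlis4) auto
  have "?E = (\<Sum>i<n. \<Sum>j<n. of_bool (i = j) * A i j * (\<Sum>k<n. A k k) + (A i j)\<^sup>2 + A i j * A j i)"
  proof (intro sum.cong refl)
    fix i j assume ij: "i \<in> {..<n}" "j \<in> {..<n}"
    have "(\<Sum>k<n. \<Sum>l<n. A i j * A k l * (of_bool (i = j) * of_bool (k = l)))
        = (\<Sum>k<n. \<Sum>l<n. (of_bool (i = j) * A i j * A k l) * of_bool (k = l))" by (simp add: mult_ac)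
    also have "\<dots> = of_bool (i = j) * A i j * (\<Sum>k<n. A k k)"
      by (simp add: sum_mult_of_bool sum_distrib_left)
    finally have 1: "(\<Sum>k<n. \<Sum>l<n. A i j * A k l * (of_bool (i = j) * of_bool (k = l))) = \<dots>" .
    have "(\<Sum>k<n. \<Sum>l<n. A i j * A k l * (of_bool (i = k) * of_bool (j = l)))
        = (\<Sum>k<n. (\<Sum>l<n. (A i j * A k l) * of_bool (j = l)) * of_bool (i = k))"
      unfolding sum_distrib_right by (simp add: mult_ac)
    also have "\<dots> = (A i j)\<^sup>2"
      using ij by (simp add: sum_mult_of_bool power2_eq_square)
    finally have 2: "(\<Sum>k<n. \<Sum>l<n. A i j * A k l * (of_bool (i = k) * of_bool (j = l))) = \<dots>" .
    have "(\<Sum>k<n. \<Sum>l<n. A i j * A k l * (of_bool (i = l) * of_bool (j = k)))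
        = (\<Sum>k<n. (\<Sum>l<n. (A i j * A k l) * of_bool (i = l)) * of_bool (j = k))"
      unfolding sum_distrib_right by (simp add: mult_ac)
    also have "\<dots> = A i j * A j i"
      using ij by (simp add: sum_mult_of_bool)
    finally have 3: "(\<Sum>k<n. \<Sum>l<n. A i j * A k l * (of_bool (i = l) * of_bool (j = k))) = \<dots>" .
    show "(\<Sum>k<n. \<Sum>l<n. A i j * A k l *
      (of_bool (i = j) * of_bool (k = l) + of_bool (i = k) * of_bool (j = l) + of_bool (i = l) * of_bool (j = k)))
      = of_bool (i = j) * A i j * (\<Sum>k<n. A k k) + (A i j)\<^sup>2 + A i j * A j i"
      unfolding distrib_left sum.distrib 1 2 3 ..
  qed
  also have "\<dots> = (\<Sum>i<n. \<Sum>j<n. (A i j * (\<Sum>k<n. A k k)) * of_bool (i = j)) + (\<Sum>i<n. \<Sum>j<n. (A i j)\<^sup>2 + A i j * A j i)"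
    by (simp add: sum.distrib mult_ac)
  also have "(\<Sum>i<n. \<Sum>j<n. (A i j * (\<Sum>k<n. A k k)) * of_bool (i = j)) = (\<Sum>i<n. A i i)\<^sup>2"
    by (simp add: sum_mult_of_bool power2_eq_square sum_distrib_right)
  also have "(\<Sum>i<n. \<Sum>j<n. (A i j)\<^sup>2 + A i j * A j i) = (\<Sum>i<n. \<Sum>j<n. 2 * (A i j)\<^sup>2)"
    by (intro sum.cong refl) (use sym in \<open>auto simp: power2_eq_square\<close>)
  finally have E: "?E = (\<Sum>i<n. A i i)\<^sup>2 + 2 * (\<Sum>i<n. \<Sum>j<n. (A i j)\<^sup>2)" by (simp add: sum_distrib_left)
  have "variance Q = 2 * (\<Sum>i<n. \<Sum>j<n. (A i j)\<^sup>2)"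
    using EQ EQ2 unfolding E has_bochner_integral_iff by (subst variance_eq) auto
  then show ?thesis
    using Chebyshev_inequality[of Q t] EQ EQ2 t unfolding has_bochner_integral_iff by (simp add: Q_def)
qed

lemma linear_form_std_normal:
  assumes c: "(\<Sum>j<n. (c j)\<^sup>2) = 1"
  shows "distributed M lborel (\<lambda>y. \<Sum>j<n. c j * u j y) std_normal_density"
proof -
  interpret P: product_prob_space N by (rule product_prob_space_N)
  \<comment> \<open>Zero coefficients are dropped, since a normal summand needs a positive standard
    deviation.\<close>
  define J where "J = {j. j < n \<and> c j \<noteq> 0}"
  have n0: "{..<n} \<noteq> {}" using c by (cases "n = 0") auto
  have dN: "distr M borel (\<lambda>y. y j) = N j" if "j < n" for j
  proof -
    have "distr M borel (\<lambda>y. y j) = distr M (N j) (\<lambda>y. y j)" by (rule distr_cong) auto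
    also have "\<dots> = N j" unfolding M_def using that by (intro distr_PiM_component prob_space_N) auto
    finally show ?thesis .
  qed
  have ind: "indep_vars (\<lambda>_. borel) (\<lambda>j y. y j) {..<n}"
  proof (subst indep_vars_iff_distr_eq_PiM'[OF n0])
    \<comment> \<open>Restriction to the index set is the identity on the space of \<open>M\<close>,
      whose elements are extensional; the joint law of the coordinates is thus \<open>M\<close>
      itself.\<close>
    have "distr M (PiM {..<n} (\<lambda>_. borel)) (\<lambda>x. \<lambda>i\<in>{..<n}. x i) = distr M M (\<lambda>x. x)"
      by (rule distr_cong) (auto simp: sets_M, auto simp: M_def space_PiM)
    also have "\<dots> = M" by (rule distr_id)
    also have "M = PiM {..<n} (\<lambda>i. distr M borel (\<lambda>x. x i))"
      by (subst (1) M_def, rule PiM_cong) (auto simp: dN)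
    finally show "distr M (PiM {..<n} (\<lambda>_. borel)) (\<lambda>x. \<lambda>i\<in>{..<n}. x i) = PiM {..<n} (\<lambda>i. distr M borel (\<lambda>x. x i))" .
  qed auto
  have dist: "distributed M lborel (\<lambda>y. c j * u j y) (normal_density 0 \<bar>c j\<bar>)" if "j \<in> J" for j
  proof -
    have "distributed M lborel (\<lambda>y. y j) (normal_density (\<mu> j) \<sigma>)"
      unfolding distributed_def using that dN[of j] by (auto simp: J_def cong: distr_cong)
    then have "distributed M lborel (u j) std_normal_density"
      unfolding u_def[abs_def] by (rule iffD1[OF normal_standard_normal_convert[OF \<sigma>_pos]])
    from normal_density_affine[OF this, of "c j" 0] that show ?thesis by (simp add: J_def)
  qed
  have indJ: "indep_vars (\<lambda>_. borel) (\<lambda>j y. c j * u j y) J"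
  proof -
    have "indep_vars (\<lambda>_. borel) (\<lambda>j y. c j * ((y j - \<mu> j) / \<sigma>)) {..<n}"
      by (rule indep_vars_compose2[OF ind]) auto
    then show ?thesis unfolding u_def by (rule indep_vars_subset) (auto simp: J_def)
  qed
  have s: "(\<Sum>j\<in>J. f j) = (\<Sum>j<n. f j)" if "\<And>j. j < n \<Longrightarrow> c j = 0 \<Longrightarrow> f j = 0" for f :: "nat \<Rightarrow> real"
    by (rule sum.mono_neutral_left) (use that in \<open>auto simp: J_def\<close>)
  have "J \<noteq> {}" using c s[of "\<lambda>j. (c j)\<^sup>2"] by auto
  then have "distributed M lborel (\<lambda>y. \<Sum>j\<in>J. c j * u j y) (normal_density (\<Sum>j\<in>J. 0) (sqrt (\<Sum>j\<in>J. \<bar>c j\<bar>\<^sup>2)))"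
    by (intro sum_indep_normal indJ dist) (auto simp: J_def)
  then show ?thesis using c s[of "\<lambda>j. (c j)\<^sup>2"] by (simp add: s)
qed

end

section \<open>Least squares\<close>

lemma mult_mat_index_sum:
  assumes "A \<in> carrier_mat n m" "B \<in> carrier_mat m p" "i < n" "j < p"
  shows "(A * B) $$ (i, j) = (\<Sum>l<m. A $$ (i, l) * B $$ (l, j))"
  using assms by (auto simp: scalar_prod_def atLeast0LessThan intro!: sum.cong)

lemma mult_mat_vec_index_sum:
  assumes "A \<in> carrier_mat n m" "v \<in> carrier_vec m" "i < n"
  shows "(A *\<^sub>v v) $ i = (\<Sum>l<m. A $$ (i, l) * v $ l)"
  using assms by (auto simp: scalar_prod_def atLeast0LessThan intro!: sum.cong)

lemma scalar_prod_self_eq_0: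
  fixes v :: "real vec"
  assumes "v \<in> carrier_vec n" "scalar_prod v v = 0"
  shows "v = 0\<^sub>v n"
proof -
  have "(\<Sum>i\<in>{0..<n}. v $ i * v $ i) = 0" using assms by (auto simp: scalar_prod_def)
  then have "\<forall>i\<in>{0..<n}. v $ i * v $ i = 0" by (subst (asm) sum_nonneg_eq_0_iff) auto
  then show ?thesis using assms by (intro eq_vecI) auto
qed

text \<open>Linear independence concerns the set of columns, so repeated columns must be excluded
  first: a maximal independent subset already has \<open>nc\<close> elements.\<close>

lemma (in vec_space) full_rank_mult_eq_0:
  assumes A: "A \<in> carrier_mat n nc" and r: "rank A = nc"
    and v: "v \<in> carrier_vec nc" "A *\<^sub>v v = 0\<^sub>v n"
  shows "v = 0\<^sub>v nc"
proof (rule ccontr)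
  assume "v \<noteq> 0\<^sub>v nc"
  obtain S where S: "maximal S (\<lambda>T. T \<subseteq> set (cols A) \<and> lin_indpt T)"
    using maximal_exists[of "(\<lambda>T. T \<subseteq> set (cols A) \<and> lin_indpt T)" "card (set (cols A))" "{}"]
    by (meson List.finite_set card_mono empty_iff empty_subsetI finite_lin_indpt2 rev_finite_subset)
  then have "nc \<le> card (set (cols A))"
    using rank_card_indpt[OF A S] r by (auto simp: maximal_def intro: card_mono)
  then have "distinct (cols A)"
    using A card_length[of "cols A"] by (intro card_distinct) auto
  then show False
    using lin_depI[OF A v(1) \<open>v \<noteq> 0\<^sub>v nc\<close> v(2)] full_rank_lin_indpt[OF A r] by blast
qed

locale full_rank_design =
  fixes X :: "real mat" and n k :: nat
  assumes X: "X \<in> carrier_mat n k" and rank_X: "vec_space.rank n X = k"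
begin

definition gram_inv :: "real mat" where "gram_inv = XtX_inv X"
definition ls_mat :: "real mat" where "ls_mat = gram_inv * transpose_mat X"
definition hat_mat :: "real mat" where "hat_mat = X * ls_mat"
definition resid_mat :: "real mat" where "resid_mat = 1\<^sub>m n - hat_mat"

lemma Xt: "transpose_mat X \<in> carrier_mat k n" using X by simp

lemma XtX: "transpose_mat X * X \<in> carrier_mat k k" using X by simp

text \<open>A kernel vector \<open>v\<close> of the Gram matrix gives \<open>X *\<^sub>v v\<close>
  squared length 0, and full column rank then forces \<open>v\<close> to vanish.\<close>

lemma gram_inv: "gram_inv \<in> carrier_mat k k" "transpose_mat X * X * gram_inv = 1\<^sub>m k" "gram_inv * (transpose_mat X * X) = 1\<^sub>m k"
proof -
  have "det (transpose_mat X * X) \<noteq> 0"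
  proof
    assume "det (transpose_mat X * X) = 0"
    then obtain v where v: "v \<in> carrier_vec k" "v \<noteq> 0\<^sub>v k" "transpose_mat X * X *\<^sub>v v = 0\<^sub>v k"
      using det_0_iff_vec_prod_zero_field[OF XtX] by auto
    have Xv: "X *\<^sub>v v \<in> carrier_vec n" using X v by simp
    have "transpose_mat X *\<^sub>v (X *\<^sub>v v) = 0\<^sub>v k" using v(3) assoc_mult_mat_vec[OF Xt X v(1)] by simp
    then have "scalar_prod (X *\<^sub>v v) (X *\<^sub>v v) = 0"
      using transpose_vec_mult_scalar[OF X v(1) Xv] v(1) by simp
    from scalar_prod_self_eq_0[OF Xv this] show False
      using vec_space.full_rank_mult_eq_0[OF X rank_X v(1)] v(2) by simp
  qed
  from det_non_zero_imp_unit[OF XtX this, of "()"] obtain B where "mat_inverse (transpose_mat X * X) = Some B"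
    using mat_inverse(1)[OF XtX, of "()"] by (cases "mat_inverse (transpose_mat X * X)") auto
  then show "gram_inv \<in> carrier_mat k k" "transpose_mat X * X * gram_inv = 1\<^sub>m k" "gram_inv * (transpose_mat X * X) = 1\<^sub>m k"
    using mat_inverse(2)[OF XtX] by (auto simp: gram_inv_def XtX_inv_def)
qed

lemma gram_inv_sym: "transpose_mat gram_inv = gram_inv"
proof -
  have Gt: "transpose_mat gram_inv \<in> carrier_mat k k" using gram_inv by simp
  have "transpose_mat (transpose_mat X * X * gram_inv) = transpose_mat gram_inv * (transpose_mat X * X)"
    using transpose_mult[OF XtX gram_inv(1)] transpose_mult[OF Xt X] by simp
  then have 1: "transpose_mat gram_inv * (transpose_mat X * X) = 1\<^sub>m k" using gram_inv(2) by simp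
  have "transpose_mat gram_inv = transpose_mat gram_inv * (transpose_mat X * X * gram_inv)" using gram_inv(2) Gt by simp
  also have "\<dots> = transpose_mat gram_inv * (transpose_mat X * X) * gram_inv" using assoc_mult_mat[OF Gt XtX gram_inv(1)] by simp
  finally show ?thesis using 1 gram_inv(1) by simp
qed

lemma ls_mat: "ls_mat \<in> carrier_mat k n" unfolding ls_mat_def using gram_inv(1) Xt by simp

lemma ls_mat_X: "ls_mat * X = 1\<^sub>m k"
  unfolding ls_mat_def using assoc_mult_mat[OF gram_inv(1) Xt X] gram_inv(3) by simp

lemma ls_mat_Ct: "ls_mat * transpose_mat ls_mat = gram_inv"
proof -
  have "transpose_mat ls_mat = X * gram_inv" unfolding ls_mat_def using transpose_mult[OF gram_inv(1) Xt] gram_inv_sym by simp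
  then have "ls_mat * transpose_mat ls_mat = ls_mat * X * gram_inv" using assoc_mult_mat[OF ls_mat X gram_inv(1)] by simp
  then show ?thesis using ls_mat_X gram_inv(1) by simp
qed

lemma theta_LS_eq: "y \<in> carrier_vec n \<Longrightarrow> theta_LS X y = ls_mat *\<^sub>v y"
  unfolding theta_LS_def ls_mat_def gram_inv_def[symmetric] using assoc_mult_mat_vec[OF gram_inv(1) Xt] by simp

text \<open>Times the noise variance, this is the variance of the least squares coordinate.\<close>

lemma ls_mat_sq: "i < k \<Longrightarrow> (\<Sum>j<n. (ls_mat $$ (i, j))\<^sup>2) = gram_inv $$ (i, i)"
  using mult_mat_index_sum[OF ls_mat, of "transpose_mat ls_mat" k i i] ls_mat ls_mat_Ct by (simp add: power2_eq_square)

text \<open>A zero row of \<open>ls_mat\<close> would contradict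
  \<open>ls_mat * X = 1\<^sub>m k\<close>.\<close>

lemma gram_inv_pos: assumes "i < k" shows "0 < gram_inv $$ (i, i)"
proof -
  have "\<exists>j<n. ls_mat $$ (i, j) \<noteq> 0"
    using mult_mat_index_sum[OF ls_mat X assms assms] ls_mat_X assms by (auto intro: ccontr)
  then show ?thesis unfolding ls_mat_sq[OF assms, symmetric]
    by (auto intro!: sum_pos2)
qed

lemma theta_LS_err:
  assumes \<theta>: "\<theta> \<in> carrier_vec k" and i: "i < k"
  shows "theta_LS X (vec n y) $ i = \<theta> $ i + (\<Sum>j<n. ls_mat $$ (i, j) * (y j - (X *\<^sub>v \<theta>) $ j))"
proof -
  have "(\<Sum>j<n. ls_mat $$ (i, j) * (X *\<^sub>v \<theta>) $ j) = (ls_mat *\<^sub>v (X *\<^sub>v \<theta>)) $ i"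
    using ls_mat X \<theta> i by (subst mult_mat_vec_index_sum) auto
  also have "\<dots> = \<theta> $ i" using assoc_mult_mat_vec[OF ls_mat X \<theta>] ls_mat_X \<theta> by simp
  finally have "(\<Sum>j<n. ls_mat $$ (i, j) * (X *\<^sub>v \<theta>) $ j) = \<theta> $ i" .
  then show ?thesis
    using i by (simp add: theta_LS_eq mult_mat_vec_index_sum[OF ls_mat] right_diff_distrib sum_subtractf)
qed

section \<open>The residual projection and the variance estimator\<close>

lemma hat_mat: "hat_mat \<in> carrier_mat n n" unfolding hat_mat_def using X ls_mat by simp

lemma hat_mat_sym: "transpose_mat hat_mat = hat_mat"
proof -
  have "transpose_mat ls_mat = X * gram_inv" unfolding ls_mat_def using transpose_mult[OF gram_inv(1) Xt] gram_inv_sym by simp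
  then have "transpose_mat hat_mat = X * gram_inv * transpose_mat X" unfolding hat_mat_def using transpose_mult[OF X ls_mat] by simp
  then show ?thesis unfolding hat_mat_def ls_mat_def using assoc_mult_mat[OF X gram_inv(1) Xt] by simp
qed

lemma hat_mat_X: "hat_mat * X = X"
  unfolding hat_mat_def using assoc_mult_mat[OF X ls_mat X] ls_mat_X X by simp

lemma hat_mat_idem: "hat_mat * hat_mat = hat_mat"
  using assoc_mult_mat[OF hat_mat X ls_mat] hat_mat_X unfolding hat_mat_def by simp

lemma resid_mat: "resid_mat \<in> carrier_mat n n" unfolding resid_mat_def using hat_mat by (rule minus_carrier_mat)

lemma resid_mat_sym: "transpose_mat resid_mat = resid_mat"
  unfolding resid_mat_def using transpose_minus[OF one_carrier_mat hat_mat] hat_mat_sym by simp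

lemma resid_mat_X: "resid_mat * X = 0\<^sub>m n k"
  unfolding resid_mat_def using minus_mult_distrib_mat[OF one_carrier_mat hat_mat X] hat_mat_X X by simp

lemma resid_mat_idem: "resid_mat * resid_mat = resid_mat"
proof -
  have "hat_mat * resid_mat = hat_mat - hat_mat * hat_mat" unfolding resid_mat_def using mult_minus_distrib_mat[OF hat_mat one_carrier_mat hat_mat] hat_mat by simp
  then have "hat_mat * resid_mat = 0\<^sub>m n n" using hat_mat_idem hat_mat by simp
  moreover have "resid_mat * resid_mat = resid_mat - hat_mat * resid_mat"
    using minus_mult_distrib_mat[OF one_carrier_mat hat_mat resid_mat] resid_mat unfolding resid_mat_def[symmetric] by simp
  ultimately show ?thesis using resid_mat by (auto intro!: eq_matI)
qed

lemma resid_mat_index_sym: "i < n \<Longrightarrow> j < n \<Longrightarrow> resid_mat $$ (i, j) = resid_mat $$ (j, i)"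
  using arg_cong[OF resid_mat_sym, of "\<lambda>B. B $$ (i, j)"] resid_mat by simp

text \<open>Cyclicity of the trace reduces the trace of \<open>hat_mat\<close> to that of
  \<open>ls_mat * X\<close>, an identity matrix of size \<open>k\<close>.\<close>

lemma resid_mat_trace: "(\<Sum>i<n. resid_mat $$ (i, i)) = real n - real k"
proof -
  have "(\<Sum>i<n. hat_mat $$ (i, i)) = (\<Sum>i<n. \<Sum>l<k. X $$ (i, l) * ls_mat $$ (l, i))"
    unfolding hat_mat_def using mult_mat_index_sum[OF X ls_mat] by simp
  also have "\<dots> = (\<Sum>l<k. \<Sum>i<n. ls_mat $$ (l, i) * X $$ (i, l))"
    by (subst sum.swap) (simp add: mult.commute)
  also have "\<dots> = (\<Sum>l<k. (ls_mat * X) $$ (l, l))"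
    using mult_mat_index_sum[OF ls_mat X] by simp
  also have "\<dots> = real k" using ls_mat_X by simp
  finally show ?thesis using hat_mat by (simp add: resid_mat_def sum_subtractf)
qed

text \<open>Symmetry and idempotence turn the squared norm of each row into its diagonal
  entry.\<close>

lemma resid_mat_sq: "(\<Sum>i<n. \<Sum>j<n. (resid_mat $$ (i, j))\<^sup>2) = real n - real k"
proof -
  have "(\<Sum>j<n. (resid_mat $$ (i, j))\<^sup>2) = resid_mat $$ (i, i)" if "i < n" for i
    using mult_mat_index_sum[OF resid_mat resid_mat that that] resid_mat_idem resid_mat_index_sym that by (simp add: power2_eq_square)
  then show ?thesis using resid_mat_trace by simp
qed

text \<open>\<open>resid_mat\<close> annihilates \<open>X\<close>, so the residual depends only on
  the noise; symmetry and idempotence make its squared length a quadratic form.\<close>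

lemma sigma2_hat_eq:
  assumes \<theta>: "\<theta> \<in> carrier_vec k"
  shows "sigma2_hat X (vec n y) = (\<Sum>i<n. \<Sum>j<n. resid_mat $$ (i, j) *
    ((y i - (X *\<^sub>v \<theta>) $ i) * (y j - (X *\<^sub>v \<theta>) $ j))) / (real n - real k)"
proof -
  define v where "v = vec n y"
  define w where "w = v - X *\<^sub>v \<theta>"
  have v: "v \<in> carrier_vec n" by (simp add: v_def)
  have w: "w \<in> carrier_vec n" using v X \<theta> by (simp add: w_def)
  have "v - X *\<^sub>v theta_LS X v = v - hat_mat *\<^sub>v v"
    using theta_LS_eq[OF v] assoc_mult_mat_vec[OF X ls_mat v] by (simp add: hat_mat_def)
  also have "\<dots> = resid_mat *\<^sub>v v"
    unfolding resid_mat_def using minus_mult_distrib_mat_vec[OF one_carrier_mat hat_mat v] v by simp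
  also have "\<dots> = resid_mat *\<^sub>v w"
  proof -
    have "resid_mat *\<^sub>v w = resid_mat *\<^sub>v v - resid_mat *\<^sub>v (X *\<^sub>v \<theta>)"
      unfolding w_def using mult_minus_distrib_mat_vec[OF resid_mat v] X \<theta> by simp
    also have "resid_mat *\<^sub>v (X *\<^sub>v \<theta>) = 0\<^sub>v n"
    proof -
      have "0\<^sub>m n k *\<^sub>v \<theta> = 0\<^sub>v n" using \<theta> by (intro eq_vecI) auto
      then show ?thesis using assoc_mult_mat_vec[OF resid_mat X \<theta>] unfolding resid_mat_X by simp
    qed
    finally show ?thesis using resid_mat v by simp
  qed
  finally have r: "v - X *\<^sub>v theta_LS X v = resid_mat *\<^sub>v w" .
  have Aw: "resid_mat *\<^sub>v w \<in> carrier_vec n" using resid_mat w by simp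
  have "scalar_prod (resid_mat *\<^sub>v w) (resid_mat *\<^sub>v w) = scalar_prod (resid_mat *\<^sub>v (resid_mat *\<^sub>v w)) w"
    using transpose_vec_mult_scalar[OF resid_mat w Aw] resid_mat_sym by simp
  also have "resid_mat *\<^sub>v (resid_mat *\<^sub>v w) = resid_mat *\<^sub>v w" using assoc_mult_mat_vec[OF resid_mat resid_mat w] resid_mat_idem by simp
  also have "scalar_prod (resid_mat *\<^sub>v w) w = (\<Sum>i<n. (\<Sum>j<n. resid_mat $$ (i, j) * w $ j) * w $ i)"
    using w mult_mat_vec_index_sum[OF resid_mat w] by (simp add: scalar_prod_def atLeast0LessThan)
  also have "\<dots> = (\<Sum>i<n. \<Sum>j<n. resid_mat $$ (i, j) * (w $ i * w $ j))"
    by (simp add: sum_distrib_left sum_distrib_right mult_ac)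
  also have "\<dots> = (\<Sum>i<n. \<Sum>j<n. resid_mat $$ (i, j) * ((y i - (X *\<^sub>v \<theta>) $ i) * (y j - (X *\<^sub>v \<theta>) $ j)))"
    using X by (intro sum.cong refl) (simp add: w_def v_def)
  finally have "scalar_prod (resid_mat *\<^sub>v w) (resid_mat *\<^sub>v w) =
    (\<Sum>i<n. \<Sum>j<n. resid_mat $$ (i, j) * ((y i - (X *\<^sub>v \<theta>) $ i) * (y j - (X *\<^sub>v \<theta>) $ j)))" .
  then show ?thesis
    using X by (simp add: sigma2_hat_def v_def[symmetric] r Let_def)
qed

end

section \<open>Coverage in the regression model\<close>

locale regression = full_rank_design +
  fixes i :: nat
  assumes i: "i < k" and kn: "k < n"
begin

text \<open>The standard error of the coefficient at unit noise level.\<close>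

definition \<tau> :: real where "\<tau> = sqrt (gram_inv $$ (i, i))"
definition m :: real where "m = real n - real k"

definition Z :: "real vec \<Rightarrow> real \<Rightarrow> (nat \<Rightarrow> real) \<Rightarrow> real" where
  "Z \<theta> s y = (theta_LS X (vec n y) $ i - \<theta> $ i) / (s * \<tau>)"

definition S :: "real \<Rightarrow> (nat \<Rightarrow> real) \<Rightarrow> real" where
  "S s y = sqrt (sigma2_hat X (vec n y)) / s"

lemma \<tau>_pos: "0 < \<tau>" using gram_inv_pos[OF i] by (simp add: \<tau>_def)

lemma m_pos: "0 < m" using kn by (simp add: m_def)

lemma xi_eq: "(xi X i)\<^sup>2 = real n * \<tau>\<^sup>2"
  using gram_inv_pos[OF i] X by (simp add: xi_def \<tau>_def gram_inv_def)

lemma sigma2_hat_nonneg: "0 \<le> sigma2_hat X y"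
  using kn X by (auto simp: sigma2_hat_def Let_def scalar_prod_def intro!: divide_nonneg_nonneg sum_nonneg)

text \<open>Division by \<open>s * \<tau>\<close>. The factor \<open>c\<close> is the ratio of the
  noise level used to the true one: \<open>S s y\<close>, which may be 0, or 1 when the variance is
  known.\<close>

lemma soft_event_iff:
  assumes s: "0 < s" and c: "0 \<le> c"
  shows "\<bar>\<theta> $ i - soft (theta_LS X (vec n y) $ i) ((s * c)\<^sup>2 * (xi X i)\<^sup>2 * h\<^sup>2)\<bar> \<le> s * c * b \<longleftrightarrow>
    \<bar>\<theta> $ i / (s * \<tau>) - soft (\<theta> $ i / (s * \<tau>) + Z \<theta> s y) (c\<^sup>2 * (sqrt (real n) * h)\<^sup>2)\<bar> \<le> c * (b / \<tau>)"
proof -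
  have st: "0 < s * \<tau>" using s \<tau>_pos by simp
  define \<nu> where "\<nu> = \<theta> $ i / (s * \<tau>)"
  have 1: "theta_LS X (vec n y) $ i = (s * \<tau>) * (\<nu> + Z \<theta> s y)"
    using s \<tau>_pos by (simp add: \<nu>_def Z_def field_simps)
  have 2: "(s * c)\<^sup>2 * (xi X i)\<^sup>2 * h\<^sup>2 = (s * \<tau>)\<^sup>2 * (c\<^sup>2 * (sqrt (real n) * h)\<^sup>2)"
    by (simp add: xi_eq power_mult_distrib)
  have 3: "\<theta> $ i = (s * \<tau>) * \<nu>" using s \<tau>_pos by (simp add: \<nu>_def)
  have 4: "s * c * b = (s * \<tau>) * (c * (b / \<tau>))" using \<tau>_pos by simp
  have "\<bar>(s * \<tau>) * x - (s * \<tau>) * z\<bar> \<le> (s * \<tau>) * w \<longleftrightarrow> \<bar>x - z\<bar> \<le> w" for x z w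
  proof -
    have "\<bar>(s * \<tau>) * x - (s * \<tau>) * z\<bar> = (s * \<tau>) * \<bar>x - z\<bar>"
      by (simp only: right_diff_distrib[symmetric] abs_mult[of "s * \<tau>"] abs_of_pos[OF st])
    then show ?thesis by (simp only: mult_le_cancel_left_pos[OF st])
  qed
  then show ?thesis
    unfolding \<nu>_def[symmetric] unfolding 1 2 3 4 soft_scale[OF st] .
qed

end

section \<open>Laws of the standardised error and of the scale ratio\<close>

locale regression_law = regression +
  fixes \<theta> :: "real vec" and s :: real
  assumes \<theta>: "\<theta> \<in> carrier_vec k" and s: "0 < s"
begin

sublocale gauss_sample n "\<lambda>j. (X *\<^sub>v \<theta>) $ j" s
  by unfold_locales (rule s)

lemma y_law_eq: "y_law X \<theta> s = M"
  using X by (simp add: y_law_def M_def)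

lemma Z_eq: "Z \<theta> s = (\<lambda>y. \<Sum>j<n. (ls_mat $$ (i, j) / \<tau>) * u j y)"
proof
  fix y
  have "Z \<theta> s y = (\<Sum>j<n. ls_mat $$ (i, j) * (y j - (X *\<^sub>v \<theta>) $ j)) / (s * \<tau>)"
    using theta_LS_err[OF \<theta> i] by (simp add: Z_def)
  then show "Z \<theta> s y = (\<Sum>j<n. (ls_mat $$ (i, j) / \<tau>) * u j y)"
    by (simp add: u_def sum_divide_distrib mult_ac)
qed

lemma Z_std_normal: "distributed M lborel (Z \<theta> s) std_normal_density"
  unfolding Z_eq
proof (rule linear_form_std_normal)
  show "(\<Sum>j<n. (ls_mat $$ (i, j) / \<tau>)\<^sup>2) = 1"
    using ls_mat_sq[OF i] gram_inv_pos[OF i] by (simp add: power_divide \<tau>_def flip: sum_divide_distrib)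
qed

definition Q :: "(nat \<Rightarrow> real) \<Rightarrow> real" where
  "Q y = (\<Sum>i<n. \<Sum>j<n. resid_mat $$ (i, j) * (u i y * u j y))"

lemma sigma2_hat_Q: "sigma2_hat X (vec n y) = s\<^sup>2 * (Q y / m)"
proof -
  have "s\<^sup>2 * Q y = (\<Sum>i<n. \<Sum>j<n. resid_mat $$ (i, j) * ((y i - (X *\<^sub>v \<theta>) $ i) * (y j - (X *\<^sub>v \<theta>) $ j)))"
    unfolding Q_def sum_distrib_left u_def using s by (intro sum.cong refl) (simp add: power2_eq_square)
  then show ?thesis unfolding sigma2_hat_eq[OF \<theta>] m_def by simp
qed

lemma S_sq: "(S s y)\<^sup>2 = Q y / m" "0 \<le> S s y"
  using sigma2_hat_nonneg[of "vec n y"] s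
  by (simp_all add: S_def power_divide, simp add: sigma2_hat_Q)

lemma measurable_Q [measurable]: "Q \<in> borel_measurable M"
  unfolding Q_def by measurable

lemma measurable_S [measurable]: "S s \<in> borel_measurable M"
  unfolding S_def sigma2_hat_Q by measurable

text \<open>As \<open>S s y \<ge> 0\<close>, \<open>\<bar>S s y - 1\<bar>\<close> is at most
  \<open>\<bar>(S s y)\<^sup>2 - 1\<bar>\<close>, and \<open>(S s y)\<^sup>2 = Q y / m\<close> has
  mean 1 and variance \<open>2 / m\<close>.\<close>

lemma S_deviation:
  assumes \<delta>: "0 < \<delta>"
  shows "prob {y \<in> space M. \<delta> < \<bar>S s y - 1\<bar>} \<le> 2 / (m * \<delta>\<^sup>2)"
proof -
  have "prob {y \<in> space M. \<delta> < \<bar>S s y - 1\<bar>} \<le> prob {y \<in> space M. m * \<delta> \<le> \<bar>Q y - m\<bar>}"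
  proof (rule finite_measure_mono)
    show "{y \<in> space M. \<delta> < \<bar>S s y - 1\<bar>} \<subseteq> {y \<in> space M. m * \<delta> \<le> \<bar>Q y - m\<bar>}"
    proof safe
      fix y assume "\<delta> < \<bar>S s y - 1\<bar>"
      also have "\<dots> \<le> \<bar>S s y - 1\<bar> * (S s y + 1)"
        using S_sq(2)[of y] by (simp add: mult_le_cancel_left1)
      also have "\<dots> = \<bar>(S s y)\<^sup>2 - 1\<bar>"
        using S_sq(2)[of y] by (simp add: power2_eq_square square_diff_one_factored abs_mult)
      finally have "m * \<delta> \<le> m * \<bar>Q y / m - 1\<bar>" unfolding S_sq using m_pos by simp
      also have "\<dots> = \<bar>m * (Q y / m - 1)\<bar>" using m_pos by (simp add: abs_mult)
      also have "m * (Q y / m - 1) = Q y - m" using m_pos by (simp add: right_diff_distrib)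
      finally show "m * \<delta> \<le> \<bar>Q y - m\<bar>" .
    qed
  qed measurable
  also have "\<dots> \<le> 2 * m / (m * \<delta>)\<^sup>2"
    using quadratic_form_deviation[of "\<lambda>i j. resid_mat $$ (i, j)" "m * \<delta>"] resid_mat_index_sym resid_mat_trace resid_mat_sq m_pos \<delta>
    by (simp add: Q_def m_def)
  also have "\<dots> = 2 / (m * \<delta>\<^sup>2)" using m_pos by (simp add: power2_eq_square field_simps)
  finally show ?thesis .
qed

lemma Pr_feasible:
  "Pr X \<theta> s (\<lambda>y. \<bar>\<theta> $ i - theta_AS_feas X i h y\<bar> \<le> sqrt (sigma2_hat X y) * b) =
    prob {y \<in> space M. \<bar>\<theta> $ i / (s * \<tau>) - soft (\<theta> $ i / (s * \<tau>) + Z \<theta> s y) ((S s y)\<^sup>2 * (sqrt (real n) * h)\<^sup>2)\<bar> \<le> S s y * (b / \<tau>)}"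
proof -
  have 1: "sqrt (sigma2_hat X (vec n y)) = s * S s y" for y using s by (simp add: S_def)
  then have 2: "sigma2_hat X (vec n y) = (s * S s y)\<^sup>2" for y
    using sigma2_hat_nonneg[of "vec n y"] by (metis real_sqrt_pow2)
  have "\<bar>\<theta> $ i - soft (theta_LS X (vec n y) $ i) (sigma2_hat X (vec n y) * (xi X i)\<^sup>2 * h\<^sup>2)\<bar>
      \<le> sqrt (sigma2_hat X (vec n y)) * b \<longleftrightarrow>
    \<bar>\<theta> $ i / (s * \<tau>) - soft (\<theta> $ i / (s * \<tau>) + Z \<theta> s y) ((S s y)\<^sup>2 * (sqrt (real n) * h)\<^sup>2)\<bar>
      \<le> S s y * (b / \<tau>)" for y
    using soft_event_iff[OF s S_sq(2)[of y], of \<theta> y h b] unfolding 2[symmetric] unfolding 1[symmetric] .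
  then show ?thesis
    using X unfolding Pr_def y_law_eq theta_AS_feas_def by simp
qed

lemma Pr_known:
  "Pr X \<theta> s (\<lambda>y. \<bar>\<theta> $ i - theta_AS X s i h y\<bar> \<le> s * b) =
    prob {y \<in> space M. \<bar>\<theta> $ i / (s * \<tau>) - soft (\<theta> $ i / (s * \<tau>) + Z \<theta> s y) (1\<^sup>2 * (sqrt (real n) * h)\<^sup>2)\<bar> \<le> 1 * (b / \<tau>)}"
  using X soft_event_iff[OF s, of 1 \<theta> _ h b] unfolding Pr_def y_law_eq theta_AS_def by simp

end

section \<open>Comparison of the two infima\<close>

context regression
begin

lemma law: "\<theta> \<in> carrier_vec k \<Longrightarrow> 0 < s \<Longrightarrow> regression_law X n k i \<theta> s"
  by unfold_locales

text \<open>Both infima are close to \<open>min_cover \<alpha> e\<close>, which depends on neither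
  the coefficients nor the noise level; the additional infimum over the latter is therefore
  harmless.\<close>

lemma infimal_coverage_diff:
  fixes h b \<sigma> :: real
  defines "r \<equiv> (1 + sqrt (real n) * h) / sqrt m"
  assumes h: "0 < h" and b: "0 \<le> b" and \<sigma>: "0 < \<sigma>" and r: "sqrt r \<le> 1 / 12"
  shows "\<bar>(INF p \<in> carrier_vec k \<times> {0<..}.
         Pr X (fst p) (snd p) (\<lambda>y. \<bar>fst p $ i - theta_AS_feas X i h y\<bar> \<le> sqrt (sigma2_hat X y) * b))
    - (INF \<theta> \<in> carrier_vec k. Pr X \<theta> \<sigma> (\<lambda>y. \<bar>\<theta> $ i - theta_AS X \<sigma> i h y\<bar> \<le> \<sigma> * b))\<bar>
    \<le> 2 * r + 20 * sqrt r"
    (is "\<bar>(INF p \<in> _. ?f p) - (INF \<theta> \<in> _. ?g \<theta>)\<bar> \<le> _")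
proof -
  define e where "e = sqrt (real n) * h"
  define \<alpha> where "\<alpha> = b / \<tau>"
  \<comment> \<open>This choice makes the perturbation error \<open>\<delta> * (1 + e)\<close> equal
    to \<open>sqrt r\<close> and the Chebyshev bound equal to \<open>2 * r\<close>.\<close>
  define \<delta> where "\<delta> = 1 / sqrt ((1 + e) * sqrt m)"
  have e: "0 < e" using h kn by (simp add: e_def)
  have \<alpha>: "0 \<le> \<alpha>" using b \<tau>_pos by (simp add: \<alpha>_def)
  have sm: "0 < sqrt m" using m_pos by simp
  have \<delta>0: "0 < \<delta>" using e sm by (simp add: \<delta>_def)
  have \<delta>r: "\<delta> * (1 + e) = sqrt r"
  proof (rule real_sqrt_unique[symmetric])
    show "(\<delta> * (1 + e))\<^sup>2 = r"
    proof -
      define E where "E = 1 + e"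
      have "0 < E" using e by (simp add: E_def)
      then show ?thesis using sm unfolding \<delta>_def r_def e_def[symmetric] E_def[symmetric]
        by (simp add: power_divide power_mult_distrib power2_eq_square)
    qed
  qed (use \<delta>0 e in simp)
  have \<delta>sq: "2 / (m * \<delta>\<^sup>2) = 2 * r"
  proof -
    have "sqrt m * sqrt m = m" using m_pos by simp
    then show ?thesis using e sm m_pos unfolding \<delta>_def r_def e_def[symmetric]
      by (simp add: power_divide field_simps)
  qed
  have "\<delta> \<le> \<delta> * (1 + e)" using \<delta>0 e by simp
  then have \<delta>1: "\<delta> \<le> 1 / 12" using r \<delta>r by simp
  have err: "10 * \<delta> * (1 + e) = 10 * sqrt r" using \<delta>r by simp
  define q where "q = min_cover \<alpha> e"
  define \<nu> where "\<nu> = (1 + \<delta>) * \<alpha> + \<delta>"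
  \<comment> \<open>A nearly least favourable parameter: its standardised coordinate
    \<open>i\<close> is the \<open>\<nu>\<close> required by \<open>coverage_upper\<close>. With
    noise level \<open>\<sigma>\<close> it bounds both infima from above.\<close>
  define \<theta>0 where "\<theta>0 = vec k (\<lambda>j. if j = i then \<sigma> * \<tau> * \<nu> else 0)"
  have \<theta>0: "\<theta>0 \<in> carrier_vec k" "\<theta>0 $ i / (\<sigma> * \<tau>) = \<nu>"
    using i \<sigma> \<tau>_pos by (auto simp: \<theta>0_def)
  have f_lower: "q - 2 * r - 10 * sqrt r \<le> ?f p" if p: "p \<in> carrier_vec k \<times> {0<..}" for p
  proof -
    interpret L: regression_law X n k i "fst p" "snd p" using p by (intro law) auto
    show ?thesis
      using L.coverage_lower[OF L.Z_std_normal L.measurable_S L.S_deviation[OF \<delta>0] \<alpha> e \<delta>0 \<delta>1]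
      unfolding L.Pr_feasible q_def err[symmetric] \<delta>sq[symmetric] \<alpha>_def e_def .
  qed
  have g_lower: "q - 10 * sqrt r \<le> ?g \<theta>" if \<theta>: "\<theta> \<in> carrier_vec k" for \<theta>
  proof -
    interpret L: regression_law X n k i \<theta> \<sigma> using \<theta> \<sigma> by (rule law)
    show ?thesis
      \<comment> \<open>Known variance is the case \<open>S = 1\<close>, whose deviation probability
        is 0.\<close>
      using L.coverage_lower[OF L.Z_std_normal borel_measurable_const[of 1] _ \<alpha> e \<delta>0 \<delta>1, of 0] \<delta>0
      unfolding L.Pr_known q_def err[symmetric] \<alpha>_def e_def by simp
  qed
  interpret L: regression_law X n k i \<theta>0 \<sigma> using \<theta>0(1) \<sigma> by (rule law)
  have f_upper: "?f (\<theta>0, \<sigma>) \<le> q + 2 * r + 10 * sqrt r"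
    using L.coverage_upper[OF L.Z_std_normal L.measurable_S L.S_deviation[OF \<delta>0] \<alpha> e \<delta>0 \<delta>1 \<nu>_def]
    unfolding fst_conv snd_conv L.Pr_feasible \<theta>0(2) q_def err[symmetric] \<delta>sq[symmetric] \<alpha>_def e_def .
  have g_upper: "?g \<theta>0 \<le> q + 10 * sqrt r"
    using L.coverage_upper[OF L.Z_std_normal borel_measurable_const[of 1] _ \<alpha> e \<delta>0 \<delta>1 \<nu>_def, of 0] \<delta>0
    unfolding L.Pr_known \<theta>0(2) q_def err[symmetric] \<alpha>_def e_def by simp
  have Pr_nonneg: "0 \<le> Pr X' \<theta>' s' E" for X' \<theta>' s' E by (simp add: Pr_def)
  have "(INF p \<in> carrier_vec k \<times> {0<..}. ?f p) \<le> ?f (\<theta>0, \<sigma>)"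
    using \<theta>0(1) \<sigma> by (intro cINF_lower bdd_belowI2[of _ 0] Pr_nonneg) auto
  moreover have "(INF \<theta> \<in> carrier_vec k. ?g \<theta>) \<le> ?g \<theta>0"
    using \<theta>0(1) by (intro cINF_lower bdd_belowI2[of _ 0] Pr_nonneg) auto
  moreover have "q - 2 * r - 10 * sqrt r \<le> (INF p \<in> carrier_vec k \<times> {0<..}. ?f p)"
    using \<theta>0(1) \<sigma> by (intro cINF_greatest f_lower) auto
  moreover have "q - 10 * sqrt r \<le> (INF \<theta> \<in> carrier_vec k. ?g \<theta>)"
    using \<theta>0(1) by (intro cINF_greatest g_lower) auto
  ultimately show ?thesis using f_upper g_upper by (simp add: abs_le_iff)
qed

end

theorem theorem19:
  fixes X :: "nat \<Rightarrow> real mat" and k :: "nat \<Rightarrow> nat"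
    and i :: nat and \<eta> :: "nat \<Rightarrow> real" and a :: "nat \<Rightarrow> real" and \<sigma> :: real
  assumes X_dim: "\<And>n. n \<ge> 1 \<Longrightarrow> X n \<in> carrier_mat n (k n)"
    and k_pos: "\<And>n. n \<ge> 1 \<Longrightarrow> k n \<ge> 1"
    and X_rank: "\<And>n. n \<ge> 1 \<Longrightarrow> vec_space.rank n (X n) = k n"
    and standing: "\<exists>B. \<forall>n\<ge>1. (xi (X n) i)\<^sup>2 / real n \<le> B"
    and eta_pos: "\<And>n. \<eta> n > 0"
    and i_le_k: "eventually (\<lambda>n. i < k n) sequentially"
    and xi_eta: "(\<lambda>n. xi (X n) i * \<eta> n) \<longlonglongrightarrow> 0"
    and nk: "filterlim (\<lambda>n. real n - real (k n)) at_top sequentially"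
    and eta_rate: "(\<lambda>n. sqrt (real n) * \<eta> n / sqrt (real n - real (k n))) \<longlonglongrightarrow> 0"
    and a_nonneg: "\<And>n. a n \<ge> 0"
    and \<sigma>_pos: "\<sigma> > 0"
  shows "(\<lambda>n.
      (INF p \<in> carrier_vec (k n) \<times> {0<..}.
         Pr (X n) (fst p) (snd p)
           (\<lambda>y. \<bar>fst p $ i - theta_AS_feas (X n) i (\<eta> n) y\<bar>
                  \<le> sqrt (sigma2_hat (X n) y) * a n))
    - (INF \<theta> \<in> carrier_vec (k n).
         Pr (X n) \<theta> \<sigma>
           (\<lambda>y. \<bar>\<theta> $ i - theta_AS (X n) \<sigma> i (\<eta> n) y\<bar> \<le> \<sigma> * a n)))
    \<longlonglongrightarrow> 0"
proof -
  \<comment> \<open>\<open>r\<close> is the sum of \<open>1 / sqrt (real n - real (k n))\<close> and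
    the sequence in \<open>eta_rate\<close>, so both \<open>r\<close> and its square root tend to
    0.\<close>
  define r where "r = (\<lambda>n. (1 + sqrt (real n) * \<eta> n) / sqrt (real n - real (k n)))"
  have "(\<lambda>n. 1 / sqrt (real n - real (k n))) \<longlonglongrightarrow> 0"
    by (intro tendsto_divide_0[OF tendsto_const] filterlim_at_top_imp_at_infinity
        filterlim_compose[OF sqrt_at_top nk])
  from tendsto_add[OF this eta_rate] have r0: "r \<longlonglongrightarrow> 0"
    by (simp add: r_def add_divide_distrib)
  then have sr0: "(\<lambda>n. sqrt (r n)) \<longlonglongrightarrow> 0"
    using tendsto_real_sqrt by fastforce
  have "eventually (\<lambda>n. sqrt (r n) < 1 / 12) sequentially"
    using sr0 by (rule order_tendstoD) simp
  moreover have "eventually (\<lambda>n. real n - real (k n) > 0) sequentially"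
    using nk unfolding filterlim_at_top_dense by (rule spec)
  ultimately have "eventually (\<lambda>n.
     norm ((INF p \<in> carrier_vec (k n) \<times> {0<..}.
         Pr (X n) (fst p) (snd p)
           (\<lambda>y. \<bar>fst p $ i - theta_AS_feas (X n) i (\<eta> n) y\<bar>
                  \<le> sqrt (sigma2_hat (X n) y) * a n))
    - (INF \<theta> \<in> carrier_vec (k n).
         Pr (X n) \<theta> \<sigma>
           (\<lambda>y. \<bar>\<theta> $ i - theta_AS (X n) \<sigma> i (\<eta> n) y\<bar> \<le> \<sigma> * a n)))
      \<le> 2 * r n + 20 * sqrt (r n)) sequentially"
    using i_le_k
  proof eventually_elim
    case (elim n)
    \<comment> \<open>Follows from \<open>k n < n\<close>; the dimension and rank assumptions start
      at \<open>n = 1\<close>.\<close>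
    then have "n \<ge> 1" by linarith
    interpret regression "X n" n "k n" i
      using elim X_dim[OF \<open>n \<ge> 1\<close>] X_rank[OF \<open>n \<ge> 1\<close>] by unfold_locales auto
    show ?case
      using infimal_coverage_diff[OF eta_pos[of n] a_nonneg[of n] \<sigma>_pos] elim
      by (simp add: r_def m_def)
  qed
  moreover have "(\<lambda>n. 2 * r n + 20 * sqrt (r n)) \<longlonglongrightarrow> 0"
    using tendsto_add[OF tendsto_mult_left[OF r0, of 2] tendsto_mult_left[OF sr0, of 20]] by simp
  ultimately show ?thesis by (rule Lim_null_comparison)
qed

end
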